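(* Let $n\ge 3$, $q>1$, and let $(\mathbb{S}^n,g_0)$ be the round unit sphere. Let $f=f^{d,c}:\mathbb{S}^n\to[-1,1]$ be an isoparametric function obtained as the restriction to $\mathbb{S}^n$ of a Cartan–Münzner polynomial $F$ of degree $d$ on $\mathbb{R}^{n+1}$ with constant $c\le 0$. Consider the equation $$-\Delta_{g_0} u+\lambda u=\lambda u^q,\qquad u>0,\ \lambda>0,$$ on $f$-invariant functions $u$. For an integer $i\ge 1$ put $\mu_{di}=-di(n+di-1)$ and $\lambda_{di}=\frac{-\mu_{di}}{q-1}$, and let $s\mapsto (u^{d,c}_i(s),\lambda^{d,c}_i(s))$, $s\in(-\varepsilon,\varepsilon)$, be the smooth branch of nontrivial $f$-invariant solutions bifurcating from the trivial family $\lambda\mapsto(1,\lambda)$ at $(1,\lambda_{di})$, i.e. $u^{d,c}_i(0)=1$, $\lambda^{d,c}_i(0)=\lambda_{di}$, $u^{d,c}_i(s)\ne 1$ for $s\ne 0$, and $\frac{d u^{d,c}_i}{ds}(0)$ is a nonzero $f$-invariant eigenfunction of $-\Delta_{g_0}$ with eigenvalue $di(n+di-1)$. Then: (1) if $c=0$, then $\frac{d\lambda^{d,0}_i}{ds}(0)=0$ if and only if $i$ is odd; (2) if $c\neq 0$, then $\frac{d\lambda^{d,c}_i}{ds}(0)\ne 0$ for every $i\ge 1$.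
   Context: A Cartan–Münzner polynomial of degree $d$ is a homogeneous polynomial $F$ on $\mathbb{R}^{n+1}$ satisfying $|\nabla F|^2=d^2\|x\|^{2d-2}$ and $\Delta F=\frac12 c d^2\|x\|^{d-2}$ for a constant $c$; then $f=F|_{\mathbb{S}^n}$ takes values in $[-1,1]$ and satisfies $|\nabla f|^2=d^2(1-f^2)$, $\Delta f=-d(n+d-1)f+\frac12 cd^2$. (Here $d\in\{1,2,3,4,6\}$ and $c=m_2-m_1$ is the difference of multiplicities of principal curvatures of the isoparametric hypersurfaces.) Replacing $F$ by $-F$ changes $c$ to $-c$, so by convention $c\le 0$. A function $u$ on $\mathbb{S}^n$ is $f$-invariant if $u=\varphi\circ f$ for some function $\varphi$ on $[-1,1]$. The nonzero eigenvalues of $-\Delta_{g_0}$ restricted to $f$-invariant functions are exactly $di(n+di-1)$, $i\ge1$, each with one-dimensional eigenspace; bifurcation from these simple eigenvalues (Crandall–Rabinowitz) yields the branch in the statement. *)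

theory Defs
  imports "HOL-Analysis.Analysis"
begin

definition dderiv :: "'a::real_normed_vector \<Rightarrow> ('a \<Rightarrow> real) \<Rightarrow> 'a \<Rightarrow> real" where
  "dderiv v g x = deriv (\<lambda>t. g (x + t *\<^sub>R v)) 0"

definition iter_dderiv :: "'a::real_normed_vector list \<Rightarrow> ('a \<Rightarrow> real) \<Rightarrow> 'a \<Rightarrow> real" where
  "iter_dderiv vs g = foldr dderiv vs g"

definition smooth_on :: "'a::euclidean_space set \<Rightarrow> ('a \<Rightarrow> real) \<Rightarrow> bool" where
  "smooth_on S g \<longleftrightarrow> open S \<and>
     (\<forall>vs. set vs \<subseteq> Basis \<longrightarrow> iter_dderiv vs g differentiable_on S)"

definition eucl_lap :: "('a::euclidean_space \<Rightarrow> real) \<Rightarrow> 'a \<Rightarrow> real" where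
  "eucl_lap g x = (\<Sum>b\<in>Basis. dderiv b (dderiv b g) x)"

definition grad_sq :: "('a::euclidean_space \<Rightarrow> real) \<Rightarrow> 'a \<Rightarrow> real" where
  "grad_sq g x = (\<Sum>b\<in>Basis. (dderiv b g x)\<^sup>2)"

text \<open>Laplace--Beltrami operator of the round unit sphere, at points of the
  sphere: Euclidean Laplacian of the degree-0 homogeneous extension.\<close>
definition sphere_lap :: "('a::euclidean_space \<Rightarrow> real) \<Rightarrow> 'a \<Rightarrow> real" where
  "sphere_lap u x = eucl_lap (\<lambda>y. u (y /\<^sub>R norm y)) x"

definition homog_poly :: "nat \<Rightarrow> (real^'n \<Rightarrow> real) \<Rightarrow> bool" where
  "homog_poly d F \<longleftrightarrow> (\<exists>C :: ('n \<Rightarrow> nat) \<Rightarrow> real.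
      finite {\<alpha>. C \<alpha> \<noteq> 0} \<and> (\<forall>\<alpha>. C \<alpha> \<noteq> 0 \<longrightarrow> (\<Sum>i\<in>UNIV. \<alpha> i) = d) \<and>
      (\<forall>x. F x = (\<Sum>\<alpha>\<in>{\<alpha>. C \<alpha> \<noteq> 0}. C \<alpha> * (\<Prod>i\<in>UNIV. (x $ i) ^ (\<alpha> i)))))"

definition cartan_muenzner :: "nat \<Rightarrow> real \<Rightarrow> (real^'n \<Rightarrow> real) \<Rightarrow> bool" where
  "cartan_muenzner d c F \<longleftrightarrow> d \<ge> 1 \<and> homog_poly d F \<and>
     (\<forall>x. x \<noteq> 0 \<longrightarrow> grad_sq F x = (real d)\<^sup>2 * norm x powr (2 * real d - 2)) \<and>
     (\<forall>x. x \<noteq> 0 \<longrightarrow> eucl_lap F x = c / 2 * (real d)\<^sup>2 * norm x powr (real d - 2))"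

definition f_invariant :: "(real^'n \<Rightarrow> real) \<Rightarrow> (real^'n \<Rightarrow> real) \<Rightarrow> bool" where
  "f_invariant f u \<longleftrightarrow> (\<exists>\<phi>. \<forall>x\<in>sphere 0 1. u x = \<phi> (f x))"

end

(*
  The nonzero f-invariant eigenfunctions are Jacobi polynomials J_i in y = (1 - f)/2, with
  parameters determined by d, c and n.  Pairing the equation with J_i and expanding to second order
  in s shows that lam'(0) is a nonzero multiple of the integral of J_i^3.

  This integral is positive when alpha > beta, or alpha = beta and i is even.  With
  x^2 = 1 - y the polynomials T_{2n} = P_n^(alpha,beta), T_{2n+1} = x P_n^(alpha,beta+1) satisfy a
  two-term recurrence x T_n = (1 - A_n) T_{n+1} + A_n T_{n-1} whose coefficients A_n < 1/2 increase
  along each parity class, and a discrete d'Alembert formula for the wave equation satisfied by the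
  integrals of T_n T_m J_i has nonnegative coefficients.  For alpha = beta the same formula is applied
  to the Gegenbauer recurrence; if i is odd, the integral vanishes by parity.

  Integration over the sphere is replaced by integration of degree-0 homogeneous functions against a
  radial weight on an annulus, where Green's identity follows from translation invariance of Lebesgue
  measure.
*)
theory Submission
  imports Defs "HOL-Computational_Algebra.Polynomial"
begin

section \<open>Discrete wave equations and products of orthogonal polynomials\<close>

text \<open>For \<alpha> \<noteq> \<beta> the three-term recurrence of P_n in y has a diagonal term.
  Passing to x splits multiplication by 1 - y = x^2 into two steps through a second Jacobi family
  and removes that term, so that only neighbours occur, as in a wave equation.

  The inequalities come from the sign convention c \<le> 0, because \<alpha> - \<beta> = -c/2. For c
  < 0 the odd-indexed coefficients are strictly below 1/2 and increasing. For c = 0 they would all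
  equal 1/2: the weights 1 - 2 A_j then vanish at odd j and positivity no longer propagates along
  the diagonal. This is why the symmetric case needs its own recurrence.

  Positivity of the integral of J_i^2 is not automatic: if F is constantly -1 on the sphere, then
  \<beta> = -1 and J_i vanishes there for i > 0. It is deduced from the existence of a nonzero
  invariant eigenfunction, and it in turn yields \<beta> > -1.\<close>

text \<open>Inclusion and exclusion for characteristic triangles: the triangle below (k + m, m) is
  made of those below (k + m + 1, m - 1) and (k + m - 1, m - 1), which overlap in the one below (k +
  m, m - 2). The wave equation at (k + m, m - 1) links the four apices. The two sums run over the
  left and the right edge of the large triangle.\<close>

lemma discrete_wave_identity:
  fixes A :: "nat \<Rightarrow> real" and u :: "nat \<Rightarrow> nat \<Rightarrow> real"
  assumes A0: "A 0 = 0"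
    and wave: "\<And>n m. A (Suc n) * u (Suc n) m + (if n = 0 then 0 else (1 - A (n - 1)) * u (n - 1) m)
                  = A (Suc m) * u n (Suc m) + (if m = 0 then 0 else (1 - A (m - 1)) * u n (m - 1))"
  shows "A m * u (k + m) m = (\<Sum>j<m. (1 - A (k + j) - A j) * u (k + j) j)
           + (\<Sum>j<m. (A (k + 2 * m - j) - A j) * u (k + 2 * m - j) j)"
proof (induction m arbitrary: k rule: less_induct)
  case (less m)
  define l where "l k m = (\<Sum>j<m. (1 - A (k + j) - A j) * u (k + j) j)" for k m
  define r where "r s m = (\<Sum>j<m. (A (s - j) - A j) * u (s - j) j)" for s m
  have IH: "A m' * u (k + m') m' = l k m' + r (k + 2 * m') m'" if "m' < m" for k m'
    using less.IH[OF that, of k] by (simp add: l_def r_def)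
  have "A m * u (k + m) m = l k m + r (k + 2 * m) m"
  proof (cases m)
    case 0
    then show ?thesis by (simp add: l_def r_def A0)
  next
    case (Suc p)
    have l: "l k (Suc p) = l k p + (1 - A (k + p) - A p) * u (k + p) p" for k p
      by (simp add: l_def)
    have r: "r s (Suc p) = r s p + (A (s - p) - A p) * u (s - p) p" for s p
      by (simp add: r_def)
    show ?thesis
    proof (cases p)
      case 0
      then show ?thesis
        using wave[of "Suc k" 0] Suc by (simp add: l_def r_def A0)
    next
      case (Suc t)
      note m = \<open>m = Suc p\<close> \<open>p = Suc t\<close>
      have idx: "k + 2 + 2 * t = k + 2 * p" "k + 2 * m = k + 2 + 2 * p"
          "k + 2 * p - t = k + 2 + t" "k + 2 * m - p = k + 2 + p"
        using m by simp_all
      \<comment> \<open>Facts 1, 2 and 3 are the identities for the right neighbour, the left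
        neighbour and the overlap. Facts 4 and 5 extend the edges of the overlap by its apex, so
        that the inner edges of the two neighbours cancel.\<close>
      have 1: "A p * u (k + 2 + p) p = l (k + 2) p + r (k + 2 + 2 * p) p"
        using IH[of p "k + 2"] m by simp
      have 2: "A p * u (k + p) p = l k p + r (k + 2 * p) p"
        using IH[of p k] m by simp
      have 3: "A t * u (k + 2 + t) t = l (k + 2) t + r (k + 2 + 2 * t) t"
        using IH[of t "k + 2"] m by simp
      have 4: "l (k + 2) p = l (k + 2) t + (1 - A (k + 2 + t) - A t) * u (k + 2 + t) t"
        using l[of "k + 2" t] m by simp
      have 5: "r (k + 2 * p) p = r (k + 2 * p) t + (A (k + 2 + t) - A t) * u (k + 2 + t) t"
        using r[of "k + 2 * p" t] by (metis idx(3) m(2))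
      have 6: "l k m = l k p + (1 - A (k + p) - A p) * u (k + p) p"
        using l[of k p] m by simp
      have 7: "r (k + 2 * m) m = r (k + 2 * m) p + (A (k + 2 + p) - A p) * u (k + 2 + p) p"
        using r[of "k + 2 * m" p] by (metis idx(4) m(1))
      have 8: "A (k + 2 + p) * u (k + 2 + p) p + (1 - A (k + p)) * u (k + p) p
                  = A m * u (k + m) m + (1 - A t) * u (k + 2 + t) t"
        using wave[of "k + m" p] m by simp
      show ?thesis
        using 1 2 3 4 5 6 7 8 unfolding idx by (simp add: algebra_simps)
    qed
  qed
  then show ?case by (simp add: l_def r_def)
qed

lemma mono_parity:
  fixes A :: "nat \<Rightarrow> real"
  assumes "\<And>n. A n \<le> A (n + 2)" and "j \<le> n" and "even (n + j)"
  shows "A j \<le> A n"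
proof -
  have "A j \<le> A (j + 2 * t)" for t
  proof (induction t)
    case (Suc t)
    then show ?case using assms(1)[of "j + 2 * t"] by simp
  qed simp
  moreover obtain t where "n = j + 2 * t"
    using assms(2,3) by (metis dvd_diff_nat evenE even_add even_diff_nat le_add_diff_inverse)
  ultimately show ?thesis by simp
qed

text \<open>All contributions in \<open>discrete_wave_identity\<close> are nonnegative: the weights
  on the left edge by \<open>Ahalf\<close>, those on the right edge by \<open>Amono\<close> when k
  is even; for odd k the values themselves vanish by \<open>parity\<close>.\<close>

lemma discrete_wave_pos:
  fixes A :: "nat \<Rightarrow> real" and u :: "nat \<Rightarrow> nat \<Rightarrow> real"
  assumes A0: "A 0 = 0" and Apos: "\<And>n. n > 0 \<Longrightarrow> A n > 0" and Ahalf: "\<And>n. A n < 1/2"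
    and Amono: "\<And>n. A n \<le> A (n + 2)"
    and wave: "\<And>n m. A (Suc n) * u (Suc n) m + (if n = 0 then 0 else (1 - A (n - 1)) * u (n - 1) m)
                  = A (Suc m) * u n (Suc m) + (if m = 0 then 0 else (1 - A (m - 1)) * u n (m - 1))"
    and parity: "\<And>n m. odd (n + m) \<Longrightarrow> u n m = 0"
    and init: "\<And>n. u n 0 \<ge> 0" and init_pos: "u (2 * i) 0 > 0" and i: "i > 0"
  shows "u (2 * i) (2 * i) > 0"
proof -
  have nonneg: "u (k + m) m \<ge> 0" for k m
  proof (induction m arbitrary: k rule: less_induct)
    case (less m)
    show ?case
    proof (cases "m = 0")
      case True
      then show ?thesis using init by simp
    next
      case False
      have "(1 - A (k + j) - A j) * u (k + j) j \<ge> 0" if "j < m" for j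
        using Ahalf[of "k + j"] Ahalf[of j] less.IH[OF that, of k] by simp
      moreover have "(A (k + 2 * m - j) - A j) * u (k + 2 * m - j) j \<ge> 0" if "j < m" for j
      proof (cases "even (k + 2 * m - j + j)")
        case True
        have "A j \<le> A (k + 2 * m - j)"
          using True that by (intro mono_parity[where A = A, OF Amono]) auto
        moreover have "u (k + 2 * (m - j) + j) j \<ge> 0"
          by (rule less.IH[OF that])
        moreover have "k + 2 * (m - j) + j = k + 2 * m - j"
          using that by simp
        ultimately show ?thesis by simp
      next
        case False
        then show ?thesis using parity by simp
      qed
      ultimately have "A m * u (k + m) m \<ge> 0"
        unfolding discrete_wave_identity[OF A0 wave] by (intro add_nonneg_nonneg sum_nonneg) auto
      then show ?thesis using Apos[of m] False by (simp add: zero_le_mult_iff)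
    qed
  qed
  have r_nonneg: "(A (2 * m - j) - A j) * u (2 * m - j) j \<ge> 0" if "j < m" for j m
  proof -
    have "A j \<le> A (2 * m - j)"
      using that by (intro mono_parity[where A = A, OF Amono]) auto
    moreover have "u (2 * (m - j) + j) j \<ge> 0"
      by (rule nonneg)
    moreover have "2 * (m - j) + j = 2 * m - j"
      using that by simp
    ultimately show ?thesis by simp
  qed
  have l_nonneg: "(1 - A j - A j) * u j j \<ge> 0" for j
    using Ahalf[of j] nonneg[of 0 j] by simp
  have id: "A m * u m m = (\<Sum>j<m. (1 - A j - A j) * u j j)
           + (\<Sum>j<m. (A (2 * m - j) - A j) * u (2 * m - j) j)" for m
    using discrete_wave_identity[OF A0 wave, of m 0] by simp
  \<comment> \<open>The right edge below (i, i) ends in (2 i, 0), where the initial value is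
    positive. Each later diagonal point has its predecessor on its left edge, with weight 1 - 2 A j
    > 0.\<close>
  have "u (i + t) (i + t) > 0" for t
  proof (induction t)
    case 0
    have "A (2 * i) * u (2 * i) 0 \<le> (\<Sum>j<i. (A (2 * i - j) - A j) * u (2 * i - j) j)"
      using member_le_sum[of 0 "{..<i}" "\<lambda>j. (A (2 * i - j) - A j) * u (2 * i - j) j"] r_nonneg[of _ i] i A0
      by simp
    moreover have "A (2 * i) * u (2 * i) 0 > 0"
      using Apos[of "2 * i"] init_pos i by simp
    moreover have "(\<Sum>j<i. (1 - A j - A j) * u j j) \<ge> 0"
      by (intro sum_nonneg l_nonneg)
    ultimately have "A i * u i i > 0" using id[of i] by linarith
    then show ?case using Apos[of i] i by (simp add: zero_less_mult_iff)
  next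
    case (Suc t)
    let ?m = "Suc (i + t)"
    have "(1 - A (i + t) - A (i + t)) * u (i + t) (i + t) \<le> (\<Sum>j<?m. (1 - A j - A j) * u j j)"
      by (rule member_le_sum) (use l_nonneg in auto)
    moreover have "(1 - A (i + t) - A (i + t)) * u (i + t) (i + t) > 0"
      using Suc Ahalf[of "i + t"] by simp
    moreover have "(\<Sum>j<?m. (A (2 * ?m - j) - A j) * u (2 * ?m - j) j) \<ge> 0"
      using r_nonneg[of _ ?m] by (intro sum_nonneg) auto
    ultimately have "A ?m * u ?m ?m > 0" using id[of ?m] by linarith
    then show ?case using Apos[of ?m] by (simp add: zero_less_mult_iff)
  qed
  from this[of i] show ?thesis by (simp add: mult_2)
qed

text \<open>Rescaling by \<open>s\<close> exchanges the roles of the raising and lowering coefficients of the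
  recurrence; in the resulting wave equation all interior contributions cancel.\<close>

lemma product_recurrence_pos:
  fixes A :: "nat \<Rightarrow> real" and T :: "nat \<Rightarrow> nat \<Rightarrow> real"
  assumes A0: "A 0 = 0" and Apos: "\<And>n. n > 0 \<Longrightarrow> A n > 0" and Ahalf: "\<And>n. A n < 1/2"
    and Amono: "\<And>n. A n \<le> A (n + 2)"
    and rec: "\<And>n m. (1 - A n) * T (Suc n) m + A n * T (n - 1) m
                  = (1 - A m) * T n (Suc m) + A m * T n (m - 1)"
    and parity: "\<And>n m. odd (n + m) \<Longrightarrow> T n m = 0"
    and init: "\<And>n. T n 0 \<ge> 0" and init_pos: "T (2 * i) 0 > 0" and i: "i > 0"
  shows "T (2 * i) (2 * i) > 0"
proof -
  define s where "s n = (\<Prod>j<n. A (Suc j) / (1 - A j))" for n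
  have g: "1 - A n > 0" for n using Ahalf[of n] by simp
  have spos: "s n > 0" for n
    unfolding s_def by (intro prod_pos) (use Apos g in auto)
  have s0: "s 0 = 1" by (simp add: s_def)
  have sS: "s (Suc n) = s n * A (Suc n) / (1 - A n)" for n
    by (simp add: s_def)
  define u where "u n m = T n m / (s n * s m)" for n m
  have up: "A (Suc n) / s (Suc n) = (1 - A n) / s n" for n
    using spos[of n] spos[of "Suc n"] Apos[of "Suc n"] g[of n]
    by (simp add: sS divide_simps less_imp_neq[symmetric])
  have down: "(1 - A (n - 1)) / s (n - 1) = A n / s n" if "n > 0" for n
    using up[of "n - 1"] that by simp
  \<comment> \<open>At n = 0 the truncated index turns \<open>T (n - 1) m\<close> into
    \<open>T 0 m\<close>, but its factor \<open>A 0\<close> is 0; this matches the \<open>if\<close>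
    in the wave equation.\<close>
  have *: "A (Suc n) * u (Suc n) m + (if n = 0 then 0 else (1 - A (n - 1)) * u (n - 1) m)
      = ((1 - A n) * T (Suc n) m + A n * T (n - 1) m) / (s n * s m)" for n m
  proof -
    have "A (Suc n) * u (Suc n) m = A (Suc n) / s (Suc n) * (T (Suc n) m / s m)"
      by (simp add: u_def)
    also have "\<dots> = (1 - A n) * T (Suc n) m / (s n * s m)"
      unfolding up by simp
    finally have 1: "A (Suc n) * u (Suc n) m = (1 - A n) * T (Suc n) m / (s n * s m)" .
    have "(1 - A (n - 1)) * u (n - 1) m = A n * T (n - 1) m / (s n * s m)" if "n > 0"
    proof -
      have "(1 - A (n - 1)) * u (n - 1) m = (1 - A (n - 1)) / s (n - 1) * (T (n - 1) m / s m)"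
        by (simp add: u_def)
      then show ?thesis unfolding down[OF that] by simp
    qed
    then show ?thesis using 1 A0 by (simp add: add_divide_distrib)
  qed
  have **: "A (Suc m) * u n (Suc m) + (if m = 0 then 0 else (1 - A (m - 1)) * u n (m - 1))
      = ((1 - A m) * T n (Suc m) + A m * T n (m - 1)) / (s n * s m)" for n m
  proof -
    have "A (Suc m) * u n (Suc m) = A (Suc m) / s (Suc m) * (T n (Suc m) / s n)"
      by (simp add: u_def)
    also have "\<dots> = (1 - A m) * T n (Suc m) / (s n * s m)"
      unfolding up by simp
    finally have 1: "A (Suc m) * u n (Suc m) = (1 - A m) * T n (Suc m) / (s n * s m)" .
    have "(1 - A (m - 1)) * u n (m - 1) = A m * T n (m - 1) / (s n * s m)" if "m > 0"
    proof -
      have "(1 - A (m - 1)) * u n (m - 1) = (1 - A (m - 1)) / s (m - 1) * (T n (m - 1) / s n)"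
        by (simp add: u_def)
      then show ?thesis unfolding down[OF that] by simp
    qed
    then show ?thesis using 1 A0 by (simp add: add_divide_distrib)
  qed
  have "u (2 * i) (2 * i) > 0"
  proof (rule discrete_wave_pos[where A = A and u = u and i = i])
    show "A (Suc n) * u (Suc n) m + (if n = 0 then 0 else (1 - A (n - 1)) * u (n - 1) m)
        = A (Suc m) * u n (Suc m) + (if m = 0 then 0 else (1 - A (m - 1)) * u n (m - 1))" for n m
      unfolding * ** rec ..
    show "u n m = 0" if "odd (n + m)" for n m
      using parity[OF that] by (simp add: u_def)
    show "u n 0 \<ge> 0" for n
      using init[of n] spos[of n] by (simp add: u_def s0)
    show "u (2 * i) 0 > 0"
      using init_pos spos[of "2 * i"] by (simp add: u_def s0)
  qed (fact A0 Apos Ahalf Amono i)+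
  then show ?thesis using spos[of "2 * i"] by (simp add: u_def zero_less_divide_iff)
qed

text \<open>The recurrence can be solved for \<open>T n (Suc p)\<close> because
  \<open>A p < 1\<close>, and it involves only entries whose index sum has the same parity. The
  claim thus spreads from the column m = 0.\<close>

lemma product_recurrence_parity:
  fixes A :: "nat \<Rightarrow> real" and T :: "nat \<Rightarrow> nat \<Rightarrow> real"
  assumes A: "\<And>n. A n < 1" and A0: "A 0 = 0"
    and rec: "\<And>n m. (1 - A n) * T (Suc n) m + A n * T (n - 1) m
                  = (1 - A m) * T n (Suc m) + A m * T n (m - 1)"
    and init: "\<And>n. odd (n + k) \<Longrightarrow> T n 0 = 0" and "odd (n + m + k)"
  shows "T n m = 0"
  using \<open>odd (n + m + k)\<close>
proof (induction m arbitrary: n rule: less_induct)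
  case (less m)
  show ?case
  proof (cases m)
    case 0
    then show ?thesis using init less.prems by simp
  next
    case (Suc p)
    have "T (Suc n) p = 0" using less.IH[of p "Suc n"] less.prems Suc by simp
    moreover have "A n * T (n - 1) p = 0"
      using less.IH[of p "n - 1"] less.prems Suc A0 by (cases n) auto
    moreover have "A p * T n (p - 1) = 0"
      using less.IH[of "p - 1" n] less.prems Suc A0 by (cases p) auto
    ultimately have "(1 - A p) * T n m = 0"
      using rec[of n p] unfolding Suc by (metis add.right_neutral mult_zero_right)
    then show ?thesis using A[of p] by simp
  qed
qed

section \<open>Normalized Jacobi polynomials: differential equation and contiguous relations\<close>

text \<open>Coefficients of the terminating Gauss series 2F1(-m, m + a; g; y), hence the value 1 at
  y = 0.\<close>

definition jacobi_coeff :: "nat \<Rightarrow> real \<Rightarrow> real \<Rightarrow> nat \<Rightarrow> real" where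
  "jacobi_coeff m a g k = pochhammer (- real m) k * pochhammer (real m + a) k / (pochhammer g k * fact k)"

text \<open>The Jacobi polynomial \<open>P_m^(\<alpha>,\<beta>)(t) / P_m^(\<alpha>,\<beta>)(1)\<close> as a polynomial
  in \<open>y = (1 - t) / 2\<close>, where \<open>a = \<alpha> + \<beta> + 1\<close> and \<open>g = \<alpha> + 1\<close>.\<close>

definition jacobi :: "nat \<Rightarrow> real \<Rightarrow> real \<Rightarrow> real poly" where
  "jacobi m a g = (\<Sum>k\<le>m. monom (jacobi_coeff m a g k) k)"

lemma jacobi_coeff_eq_0: "k > m \<Longrightarrow> jacobi_coeff m a g k = 0"
  by (simp add: jacobi_coeff_def pochhammer_of_nat_eq_0_lemma)

lemma coeff_jacobi [simp]: "coeff (jacobi m a g) k = jacobi_coeff m a g k"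
proof -
  have "coeff (jacobi m a g) k = (\<Sum>j\<le>m. if j = k then jacobi_coeff m a g j else 0)"
    by (simp add: jacobi_def coeff_sum coeff_monom)
  also have "\<dots> = (if k \<le> m then jacobi_coeff m a g k else 0)"
    by (simp add: sum.delta)
  finally show ?thesis using jacobi_coeff_eq_0[of m k a g] by auto
qed

lemma jacobi_0 [simp]: "jacobi 0 a g = 1"
  by (simp add: jacobi_def jacobi_coeff_def monom_0)

lemma jacobi_coeff_Suc:
  assumes "g > 0"
  shows "real (Suc k) * (real k + g) * jacobi_coeff m a g (Suc k)
       = (real k - real m) * (real k + real m + a) * jacobi_coeff m a g k"
proof -
  have "pochhammer g k > 0" using assms by (rule pochhammer_pos)
  then show ?thesis using assms
    by (simp add: jacobi_coeff_def pochhammer_Suc divide_simps) (simp add: algebra_simps)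
qed

text \<open>The hypergeometric equation, equivalent to the ratio of consecutive coefficients in
  \<open>jacobi_coeff_Suc\<close>. The two lowest degrees are treated apart because the factor y (1
  - y) shifts indices.\<close>

lemma jacobi_ode:
  assumes "g > 0"
  shows "[:0, 1, -1:] * pderiv (pderiv (jacobi m a g)) + [:g, - (a + 1):] * pderiv (jacobi m a g)
       = smult (- (real m * (real m + a))) (jacobi m a g)"
proof (rule poly_eqI)
  fix k
  let ?c = "jacobi_coeff m a g"
  show "coeff ([:0, 1, -1:] * pderiv (pderiv (jacobi m a g)) + [:g, - (a + 1):] * pderiv (jacobi m a g)) k
       = coeff (smult (- (real m * (real m + a))) (jacobi m a g)) k"
  proof (cases k)
    case 0
    then show ?thesis using jacobi_coeff_Suc[OF assms, of 0 m a]
      by (simp add: coeff_pderiv)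
  next
    case (Suc l)
    show ?thesis
    proof (cases l)
      case 0
      then show ?thesis using jacobi_coeff_Suc[OF assms, of 1 m a] Suc
        by (simp add: coeff_pderiv algebra_simps)
    next
      case (Suc t)
      then show ?thesis using jacobi_coeff_Suc[OF assms, of k m a] \<open>k = Suc l\<close>
        by (simp add: coeff_pderiv) (simp add: algebra_simps)
    qed
  qed
qed

text \<open>With g fixed, raising a by 1 raises \<beta> by 1 and keeps \<alpha>. The coefficients
  share a denominator, and the identities 1 and 2 produce the factors m + a + k and m - k, whose sum
  is 2 m + a.\<close>

lemma jacobi_contiguous_down:
  "smult (2 * real m + a) (jacobi m a g)
       = smult (real m + a) (jacobi m (a + 1) g) + smult (real m) (jacobi (m - 1) (a + 1) g)"
proof (rule poly_eqI)
  fix k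
  have 1: "(real m + a) * pochhammer (real m + (a + 1)) k = pochhammer (real m + a) k * (real m + a + real k)"
    using pochhammer_rec[of "real m + a" k] pochhammer_Suc[of "real m + a" k] by (simp add: add_ac)
  have 2: "real m * (pochhammer (- real (m - 1)) k * pochhammer (real (m - 1) + (a + 1)) k)
       = pochhammer (- real m) k * (real m - real k) * pochhammer (real m + a) k"
  proof (cases m)
    case (Suc l)
    have "real m * pochhammer (- real (m - 1)) k = pochhammer (- real m) k * (real m - real k)"
      using pochhammer_rec[of "- real m" k] pochhammer_Suc[of "- real m" k] Suc
      by (simp add: algebra_simps)
    moreover have "real (m - 1) + (a + 1) = real m + a"
      using Suc by simp
    ultimately show ?thesis by (metis mult.assoc)
  next
    case 0
    then show ?thesis by (cases k) (auto simp: pochhammer_0_left)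
  qed
  have "(real m + a) * jacobi_coeff m (a + 1) g k + real m * jacobi_coeff (m - 1) (a + 1) g k
    = (pochhammer (- real m) k * ((real m + a) * pochhammer (real m + (a + 1)) k)
        + real m * (pochhammer (- real (m - 1)) k * pochhammer (real (m - 1) + (a + 1)) k))
        / (pochhammer g k * fact k)"
    by (simp add: jacobi_coeff_def add_divide_distrib algebra_simps)
  also have "\<dots> = (2 * real m + a) * jacobi_coeff m a g k"
    unfolding 1 2 by (simp add: jacobi_coeff_def) (simp add: algebra_simps)
  finally show "coeff (smult (2 * real m + a) (jacobi m a g)) k
       = coeff (smult (real m + a) (jacobi m (a + 1) g) + smult (real m) (jacobi (m - 1) (a + 1) g)) k"
    by simp
qed

text \<open>The way back from \<beta> + 1 to \<beta>, at the price of the factor 1 - y; here m + a +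
  1 - g is m + \<beta> + 1. In each positive degree the four coefficients are multiples of X Y / W,
  which leaves a polynomial identity.\<close>

lemma jacobi_contiguous_up:
  assumes "g > 0"
  shows "smult (2 * real m + a + 1) ([:1, -1:] * jacobi m (a + 1) g)
       = smult (real m + g) (jacobi (Suc m) a g) + smult (real m + a + 1 - g) (jacobi m a g)"
proof (rule poly_eqI)
  fix k
  show "coeff (smult (2 * real m + a + 1) ([:1, -1:] * jacobi m (a + 1) g)) k
       = coeff (smult (real m + g) (jacobi (Suc m) a g) + smult (real m + a + 1 - g) (jacobi m a g)) k"
  proof (cases k)
    case 0
    then show ?thesis by (simp add: jacobi_coeff_def)
  next
    case (Suc l)
    define X where "X = pochhammer (- real m) l"
    define Y where "Y = pochhammer (real m + a + 1) l"
    define Z where "Z = pochhammer g l * fact l"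
    have Z: "Z > 0" using assms by (simp add: Z_def pochhammer_pos)
    have z: "pochhammer g k * fact k = Z * ((g + l) * (real l + 1))"
      by (simp add: Suc Z_def pochhammer_Suc algebra_simps)
    have gl: "g + real l > 0" using assms by simp
    have q1: "jacobi_coeff m (a + 1) g k = X * (real l - real m) * (Y * (real m + a + 1 + l)) / (Z * ((g + l) * (real l + 1)))"
      unfolding jacobi_coeff_def z by (simp add: Suc X_def Y_def pochhammer_Suc add_ac)
    have q2: "jacobi_coeff m (a + 1) g l = X * Y / Z"
      by (simp add: jacobi_coeff_def X_def Y_def Z_def add_ac)
    have q3: "jacobi_coeff (Suc m) a g k = (- real m - 1) * X * (Y * (real m + a + 1 + l)) / (Z * ((g + l) * (real l + 1)))"
    proof -
      have "pochhammer (- real (Suc m)) k = (- real m - 1) * X"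
        using pochhammer_rec[of "- real (Suc m)" l] by (simp add: Suc X_def)
      moreover have "pochhammer (real (Suc m) + a) k = Y * (real m + a + 1 + l)"
        by (simp add: Suc Y_def pochhammer_Suc add_ac)
      ultimately show ?thesis unfolding jacobi_coeff_def z by simp
    qed
    have q4: "jacobi_coeff m a g k = X * (real l - real m) * ((real m + a) * Y) / (Z * ((g + l) * (real l + 1)))"
    proof -
      have "pochhammer (- real m) k = X * (real l - real m)"
        by (simp add: Suc X_def pochhammer_Suc)
      moreover have "pochhammer (real m + a) k = (real m + a) * Y"
        using pochhammer_rec[of "real m + a" l] by (simp add: Suc Y_def)
      ultimately show ?thesis unfolding jacobi_coeff_def z by simp
    qed
    have "(2 * real m + a + 1) * (jacobi_coeff m (a + 1) g k - jacobi_coeff m (a + 1) g l)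
      = (real m + g) * jacobi_coeff (Suc m) a g k + (real m + a + 1 - g) * jacobi_coeff m a g k"
    proof -
      define W where "W = Z * ((g + l) * (real l + 1))"
      have W: "W > 0" using Z gl by (simp add: W_def)
      have "X * Y / Z = X * Y * ((g + l) * (real l + 1)) / W"
        using Z gl by (simp add: W_def)
      then show ?thesis unfolding q1 q2 q3 q4 W_def[symmetric]
        using W by (simp add: field_simps)
    qed
    then show ?thesis by (simp add: Suc)
  qed
qed

text \<open>The condition a = 2 g - 1 means \<alpha> = \<beta>, and 1 - 2 y is the classical
  variable t. Symmetry under t -> -t is why no multiple of \<open>jacobi m a g\<close> occurs on the
  right.\<close>

lemma gegenbauer_recurrence:
  assumes "g > 0" and a: "a = 2 * g - 1"
  shows "smult (2 * real m + a) ([:1, -2:] * jacobi m a g)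
       = smult (real m + a) (jacobi (Suc m) a g) + smult (real m) (jacobi (m - 1) a g)"
proof (rule poly_eqI)
  fix k
  show "coeff (smult (2 * real m + a) ([:1, -2:] * jacobi m a g)) k
       = coeff (smult (real m + a) (jacobi (Suc m) a g) + smult (real m) (jacobi (m - 1) a g)) k"
  proof (cases k)
    case 0
    then show ?thesis by (simp add: jacobi_coeff_def)
  next
    case (Suc l)
    define X where "X = pochhammer (- real m + 1) l"
    define Y where "Y = pochhammer (real m + a) l"
    define Z where "Z = pochhammer g l * fact l"
    have Z: "Z > 0" using assms by (simp add: Z_def pochhammer_pos)
    have z: "pochhammer g k * fact k = Z * ((g + l) * (real l + 1))"
      by (simp add: Suc Z_def pochhammer_Suc algebra_simps)
    have gl: "g + real l > 0" using assms by simp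
    define W where "W = Z * ((g + l) * (real l + 1))"
    have W: "W > 0" using Z gl by (simp add: W_def)
    have q1: "jacobi_coeff m a g k = (- real m) * X * (Y * (real m + a + l)) / W"
      unfolding jacobi_coeff_def z W_def by (simp add: Suc X_def Y_def pochhammer_Suc[of "real m + a" l] pochhammer_rec[of "- real m"])
    have X': "pochhammer (- real m) l * (real l - real m) = - real m * X"
      using pochhammer_rec[of "- real m" l] pochhammer_Suc[of "- real m" l] by (simp add: X_def)
    have q3: "(real m + a) * jacobi_coeff (Suc m) a g k
        = (- real m - 1) * (pochhammer (- real m) l) * (Y * (real m + a + l) * (real m + a + l + 1)) / W"
    proof -
      have "pochhammer (- real (Suc m)) k = (- real m - 1) * pochhammer (- real m) l"
        using pochhammer_rec[of "- real (Suc m)" l] by (simp add: Suc)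
      moreover have "(real m + a) * pochhammer (real (Suc m) + a) k = Y * (real m + a + l) * (real m + a + l + 1)"
      proof -
        have "(real m + a) * pochhammer (real m + a + 1) l = Y * (real m + a + l)"
          using pochhammer_rec[of "real m + a" l] pochhammer_Suc[of "real m + a" l] by (simp add: Y_def)
        moreover have "pochhammer (real (Suc m) + a) k = pochhammer (real m + a + 1) l * (real m + a + l + 1)"
          by (simp add: Suc pochhammer_Suc add_ac)
        ultimately show ?thesis by (metis mult.assoc)
      qed
      moreover have "(real m + a) * jacobi_coeff (Suc m) a g k
          = pochhammer (- real (Suc m)) k * ((real m + a) * pochhammer (real (Suc m) + a) k) / W"
        unfolding jacobi_coeff_def z W_def by (simp only: times_divide_eq_right mult_ac)
      ultimately show ?thesis by simp
    qed
    have q2: "jacobi_coeff m a g l = pochhammer (- real m) l * Y * ((g + l) * (real l + 1)) / W"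
      using Z gl by (simp add: jacobi_coeff_def Y_def Z_def W_def)
    have q4: "real m * jacobi_coeff (m - 1) a g k = real m * X * (real l + 1 - real m) * ((real m + a - 1) * Y) / W"
    proof (cases m)
      case (Suc t)
      have "pochhammer (- real (m - 1)) k = X * (real l + 1 - real m)"
        by (simp add: Suc \<open>k = Suc l\<close> X_def pochhammer_Suc)
      moreover have "pochhammer (real (m - 1) + a) k = (real m + a - 1) * Y"
        using pochhammer_rec[of "real t + a" l] by (simp add: Suc \<open>k = Suc l\<close> Y_def add_ac)
      ultimately show ?thesis unfolding jacobi_coeff_def z W_def by simp
    qed simp
    define E where "E = pochhammer (- real m) l"
    have key: "(2 * real m + a) * ((- real m) * X * (Y * (real m + a + l)) - 2 * (E * Y * ((g + l) * (real l + 1))))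
      = (- real m - 1) * E * (Y * (real m + a + l) * (real m + a + l + 1))
        + real m * X * (real l + 1 - real m) * ((real m + a - 1) * Y)"
    \<comment> \<open>X = (1 - m)_l and E = (-m)_l satisfy E (l - m) = - m X. For l \<noteq> m both
      are multiples of V = X / (m - l), and a polynomial identity remains. For l = m the relation
      says that m X = 0, which suffices together with a = 2 g - 1.\<close>
    proof (cases "l = m")
      case False
      define V where "V = X / (real m - real l)"
      have V: "X = (real m - real l) * V" using False by (simp add: V_def)
      have "E * (real l - real m) = (real m * V) * (real l - real m)"
        using X' by (simp add: E_def V algebra_simps)
      then have E: "E = real m * V" using False by simp
      have "(2 * real m + a) * (- (real m * X) * (Y * (real m + a + l)) - 2 * (E * Y * ((g + l) * (real l + 1))))
      = (- real m - 1) * E * (Y * (real m + a + l) * (real m + a + l + 1))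
        + real m * X * (real l + 1 - real m) * ((real m + a - 1) * Y)"
        unfolding V E a by algebra
      then show ?thesis by simp
    next
      case True
      have mX: "real m * X = 0" using X' True by simp
      have "(2 * real m + a) * (- (real m * X) * (Y * (real m + a + l)) - 2 * (E * Y * ((g + l) * (real l + 1))))
      = (- real m - 1) * E * (Y * (real m + a + l) * (real m + a + l + 1))
        + real m * X * (real l + 1 - real m) * ((real m + a - 1) * Y)"
        unfolding mX True a by algebra
      then show ?thesis by simp
    qed
    have "(2 * real m + a) * (jacobi_coeff m a g k - 2 * jacobi_coeff m a g l)
      = ((2 * real m + a) * ((- real m) * X * (Y * (real m + a + l)) - 2 * (E * Y * ((g + l) * (real l + 1))))) / W"
      unfolding q1 q2 E_def by (simp only: diff_divide_distrib[symmetric] times_divide_eq_right)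
    also have "\<dots> = (real m + a) * jacobi_coeff (Suc m) a g k + real m * jacobi_coeff (m - 1) a g k"
      unfolding q3 q4 key E_def[symmetric] by (rule add_divide_distrib)
    finally have "(2 * real m + a) * (jacobi_coeff m a g k - 2 * jacobi_coeff m a g l)
      = (real m + a) * jacobi_coeff (Suc m) a g k + real m * jacobi_coeff (m - 1) a g k" .
    then show ?thesis by (simp add: Suc)
  qed
qed

lemma smult_eq_cancel:
  fixes p :: "'a::field poly"
  assumes "smult c p = smult x q + smult y r" "c \<noteq> 0" "c * x' = x" "c * y' = y"
  shows "p = smult x' q + smult y' r"
proof -
  have "smult c p = smult c (smult x' q + smult y' r)"
    using assms(1,3,4) by (simp add: smult_add_right)
  then show ?thesis using assms(2) by (metis smult_cancel)
qed

section \<open>Triple products under an orthogonality functional\<close>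

text \<open>Orthogonality stands in for integration against the Jacobi weight; the instance is the
  annular average of polynomials in y. Positivity of squares is left to the individual lemmas, since
  \<open>L (jacobi i a g * jacobi i a g)\<close> can vanish in the degenerate case \<beta> =
  -1.\<close>

locale jacobi_functional =
  fixes L :: "real poly \<Rightarrow> real" and a g :: real
  assumes L_add: "L (p + q) = L p + L q" and L_smult: "L (smult c p) = c * L p"
    and a: "a > 0" and g: "g > 0"
    and orth: "n \<noteq> m \<Longrightarrow> L (jacobi n a g * jacobi m a g) = 0"
begin

text \<open>In classical terms \<open>g1\<close> is \<beta> > -1 and \<open>g2\<close> is \<alpha> >
  \<beta>. At odd indices they make A positive, below 1/2 and increasing in steps of two; at even
  indices a > 0 is responsible.\<close>

lemma jacobi_cube_pos:
  assumes pos: "L (jacobi i a g * jacobi i a g) > 0" and i: "i > 0"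
    and g1: "g < a + 1" and g2: "2 * g > a + 1"
  shows "L (jacobi i a g * jacobi i a g * jacobi i a g) > 0"
proof -
  define P where "P = (\<lambda>m. jacobi m a g)"
  define Q where "Q = (\<lambda>m. jacobi m (a + 1) g)"
  define X where "X = [:1, -1 :: real:]"
  \<comment> \<open>The lowering coefficients of \<open>jacobi_contiguous_down\<close> (n = 2 m) and
    \<open>jacobi_contiguous_up\<close> (n = 2 m + 1), divided by the factor on the left, which is n
    + a in both cases.\<close>
  define A where "A n = (if even n then real (n div 2) / (real n + a)
    else (real (n div 2) + a + 1 - g) / (real n + a))" for n
  \<comment> \<open>Two odd indices contribute x^2 = 1 - y, so the product is again a polynomial in
    y. For mixed parity one factor x is left over, and 0 stands for the integral of a function odd
    in x.\<close>
  define T where "T n m = (if even n \<and> even m then L (P (n div 2) * P (m div 2) * P i)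
      else if odd n \<and> odd m then L (X * Q (n div 2) * Q (m div 2) * P i) else 0)" for n m
  have down: "P k = smult (1 - A (2 * k)) (Q k) + smult (A (2 * k)) (Q (k - 1))" for k
  proof -
    have nz: "2 * real k + a \<noteq> 0" using a by (smt (verit) of_nat_0_le_iff)
    show ?thesis unfolding P_def Q_def
      by (rule smult_eq_cancel[OF jacobi_contiguous_down[of k a] nz]) (use nz in \<open>auto simp: A_def field_simps\<close>)
  qed
  have up: "X * Q k = smult (1 - A (Suc (2 * k))) (P (Suc k)) + smult (A (Suc (2 * k))) (P k)" for k
  proof -
    have nz: "2 * real k + a + 1 \<noteq> 0" using a by (smt (verit) of_nat_0_le_iff)
    show ?thesis unfolding P_def Q_def X_def
      by (rule smult_eq_cancel[OF jacobi_contiguous_up[OF g, of k a] nz]) (use nz in \<open>auto simp: A_def field_simps\<close>)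
  qed
  have lin: "L (R * (smult x p + smult y q) * S) = x * L (R * p * S) + y * L (R * q * S)" for R p q S x y
    by (simp add: L_add L_smult algebra_simps)
  have rec: "(1 - A n) * T (Suc n) m + A n * T (n - 1) m = (1 - A m) * T n (Suc m) + A m * T n (m - 1)"
    if "even n" "odd m" for n m
  proof -
    obtain k where n: "n = 2 * k" using \<open>even n\<close> by (elim evenE)
    obtain l where m: "m = Suc (2 * l)" using \<open>odd m\<close> by (metis oddE Suc_eq_plus1)
    have A0: "A 0 = 0" by (simp add: A_def)
    have "(1 - A n) * T (Suc n) m + A n * T (n - 1) m
       = (1 - A n) * L (X * Q l * Q k * P i) + A n * L (X * Q l * Q (k - 1) * P i)"
    proof (cases k)
      case 0
      then show ?thesis using n m A0 by (simp add: T_def mult_ac)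
    next
      case (Suc k')
      then show ?thesis using n m by (simp add: T_def mult_ac)
    qed
    also have "\<dots> = L (X * Q l * P k * P i)"
      unfolding down[of k] lin n ..
    also have "\<dots> = L (P k * (X * Q l) * P i)"
      by (simp only: mult_ac)
    also have "\<dots> = (1 - A m) * L (P k * P (Suc l) * P i) + A m * L (P k * P l * P i)"
      unfolding up lin m ..
    also have "\<dots> = (1 - A m) * T n (Suc m) + A m * T n (m - 1)"
      using n m by (simp add: T_def)
    finally show ?thesis .
  qed
  have sym: "T n m = T m n" for n m
    by (simp add: T_def mult_ac)
  have "T (2 * i) (2 * i) > 0"
  proof (rule product_recurrence_pos[where A = A and T = T and i = i])
    show "A 0 = 0" by (simp add: A_def)
    show "A n > 0" if "n > 0" for n
      using that a g1 by (auto simp: A_def intro!: divide_pos_pos)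
    show "A n < 1 / 2" for n
    proof (cases "even n")
      case True
      then show ?thesis using a by (auto simp: A_def field_simps elim!: evenE)
    next
      case False
      then show ?thesis using a g2 by (auto simp: A_def field_simps elim!: oddE)
    qed
    show "A n \<le> A (n + 2)" for n
    proof (cases "even n")
      case True
      then show ?thesis using a by (auto simp: A_def divide_simps elim!: evenE) (auto simp: algebra_simps)
    next
      case False
      then obtain k where n: "n = 2 * k + 1" by (elim oddE)
      have 1: "A n = (real k + a + 1 - g) / (2 * real k + 1 + a)"
        by (simp add: A_def n add_ac)
      have 2: "A (n + 2) = (real k + 1 + a + 1 - g) / (2 * real k + 3 + a)"
        by (simp add: A_def n add_ac)
      show ?thesis unfolding 1 2 using a g2 by (simp add: divide_simps) (auto simp: algebra_simps)
    qed
    show "(1 - A n) * T (Suc n) m + A n * T (n - 1) m = (1 - A m) * T n (Suc m) + A m * T n (m - 1)" for n m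
    proof -
      consider "even n" "odd m" | "odd n" "even m" | "even n \<longleftrightarrow> even m" by blast
      then show ?thesis
      proof cases
        case 1
        then show ?thesis by (rule rec)
      next
        case 2
        show ?thesis using rec[OF 2(2,1)]
          by (simp only: sym[of "Suc n" m] sym[of "n - 1" m] sym[of n "Suc m"] sym[of n "m - 1"])
      next
        case 3
        have "T (Suc n) m = 0" "T n (Suc m) = 0" using 3 by (auto simp: T_def)
        moreover have "A n * T (n - 1) m = 0" using 3 \<open>A 0 = 0\<close> by (cases n) (auto simp: T_def)
        moreover have "A m * T n (m - 1) = 0" using 3 \<open>A 0 = 0\<close> by (cases m) (auto simp: T_def)
        ultimately show ?thesis by (metis add.right_neutral mult_zero_right)
      qed
    qed
    show "T n m = 0" if "odd (n + m)" for n m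
      using that by (auto simp: T_def)
    show "T n 0 \<ge> 0" for n
      using orth[of "n div 2" i] pos by (cases "n div 2 = i") (auto simp: T_def P_def)
    show "T (2 * i) 0 > 0" using pos by (simp add: T_def P_def)
  qed (rule i)
  then show ?thesis by (simp add: T_def P_def)
qed

lemma gegenbauer_product_recurrence:
  fixes i n m :: nat
  assumes g2: "2 * g = a + 1"
  defines "A \<equiv> \<lambda>n. real n / (2 * real n + a)"
    and "T \<equiv> \<lambda>n m. L (jacobi n a g * jacobi m a g * jacobi i a g)"
  shows "(1 - A n) * T (Suc n) m + A n * T (n - 1) m = (1 - A m) * T n (Suc m) + A m * T n (m - 1)"
proof -
  define P where "P = (\<lambda>m. jacobi m a g)"
  define X where "X = [:1, -2 :: real:]"
  have rec: "X * P k = smult (1 - A k) (P (Suc k)) + smult (A k) (P (k - 1))" for k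
  proof -
    have nz: "2 * real k + a \<noteq> 0" using a by (smt (verit) of_nat_0_le_iff)
    have a': "a = 2 * g - 1" using g2 by simp
    show ?thesis unfolding P_def X_def
      by (rule smult_eq_cancel[OF gegenbauer_recurrence[OF g a', of k] nz]) (use nz in \<open>auto simp: A_def field_simps\<close>)
  qed
  have lin: "L (R * (smult x p + smult y q) * S) = x * L (R * p * S) + y * L (R * q * S)" for R p q S x y
    by (simp add: L_add L_smult algebra_simps)
  have "(1 - A n) * T (Suc n) m + A n * T (n - 1) m = L (P m * (X * P n) * P i)"
    unfolding rec lin by (simp add: T_def P_def mult_ac)
  also have "\<dots> = L (P n * (X * P m) * P i)"
    by (simp only: mult_ac)
  also have "\<dots> = (1 - A m) * T n (Suc m) + A m * T n (m - 1)"
    unfolding rec lin by (simp add: T_def P_def)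
  finally show ?thesis .
qed

text \<open>The recurrence respects the parity of n + m + i, and in column 0 orthogonality leaves
  only n = i; hence n = m = i gives 0 for odd i. For i = 2 e the third factor stays fixed and
  \<open>product_recurrence_pos\<close> is used with e, because the initial mass has to sit at index
  2 e.\<close>

lemma gegenbauer_cube:
  assumes g2: "2 * g = a + 1"
  shows gegenbauer_cube_odd: "odd i \<Longrightarrow> L (jacobi i a g * jacobi i a g * jacobi i a g) = 0"
    and gegenbauer_cube_even: "even i \<Longrightarrow> i > 0 \<Longrightarrow> L (jacobi i a g * jacobi i a g) > 0
           \<Longrightarrow> L (jacobi i a g * jacobi i a g * jacobi i a g) > 0"
proof -
  define A where "A = (\<lambda>n. real n / (2 * real n + a))"
  define T where "T = (\<lambda>n m. L (jacobi n a g * jacobi m a g * jacobi i a g))"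
  have A: "A n < 1 / 2" for n
    using a by (simp add: A_def field_simps)
  have rec: "(1 - A n) * T (Suc n) m + A n * T (n - 1) m = (1 - A m) * T n (Suc m) + A m * T n (m - 1)" for n m
    unfolding A_def T_def by (rule gegenbauer_product_recurrence[OF g2])
  have par: "T n m = 0" if "odd (n + m + i)" for n m
  proof (rule product_recurrence_parity[where A = A and T = T and k = i])
    show "A n < 1" for n using A[of n] by simp
    show "A 0 = 0" by (simp add: A_def)
    show "T n 0 = 0" if "odd (n + i)" for n
      using orth[of n i] that by (cases "n = i") (auto simp: T_def)
    show "(1 - A n) * T (Suc n) m + A n * T (n - 1) m = (1 - A m) * T n (Suc m) + A m * T n (m - 1)" for n m
      by (rule rec)
  qed (rule that)
  show "L (jacobi i a g * jacobi i a g * jacobi i a g) = 0" if "odd i"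
    using par[of i i] that by (simp add: T_def)
  show "L (jacobi i a g * jacobi i a g * jacobi i a g) > 0" 
    if "even i" "i > 0" and pos: "L (jacobi i a g * jacobi i a g) > 0"
  proof -
    obtain e where e: "i = 2 * e" using \<open>even i\<close> by blast
    have "T (2 * e) (2 * e) > 0"
    proof (rule product_recurrence_pos[where A = A and T = T and i = e])
      show "A 0 = 0" by (simp add: A_def)
      show "A n > 0" if "n > 0" for n
        using that a by (simp add: A_def)
      show "A n \<le> A (n + 2)" for n
        using a by (simp add: A_def divide_simps) (simp add: algebra_simps)
      show "T n m = 0" if "odd (n + m)" for n m
        using par that e by simp
      show "T n 0 \<ge> 0" for n
        using orth[of n i] pos by (cases "n = i") (auto simp: T_def)
      show "T (2 * e) 0 > 0" using pos e by (simp add: T_def)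
      show "e > 0" using that e by simp
    qed (rule A rec)+
    then show ?thesis by (simp add: T_def e)
  qed
qed

end

section \<open>Green's identity for homogeneous functions of degree 0\<close>

lemma integrable_continuous_bounded_support:
  fixes h :: "'a::euclidean_space \<Rightarrow> real"
  assumes "continuous_on UNIV h" and "\<And>x. norm x > R \<Longrightarrow> h x = 0"
  shows "integrable lborel h"
proof -
  have "integrable lborel (\<lambda>x. indicator (cball 0 R) x *\<^sub>R h x)"
    by (rule borel_integrable_compact) (auto intro: continuous_on_subset[OF assms(1)])
  also have "(\<lambda>x. indicator (cball 0 R) x *\<^sub>R h x) = h"
    using assms(2) by (auto simp: indicator_def fun_eq_iff not_le)
  finally show ?thesis .
qed

lemma integral_translate:
  fixes h :: "'a::euclidean_space \<Rightarrow> real"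
  assumes "h \<in> borel_measurable borel"
  shows "(LINT x|lborel. h (x + c)) = (LINT x|lborel. h x)"
proof -
  have "(LINT x|lborel. h x) = (LINT x|distr lborel borel ((+) c). h x)"
    by (simp add: lborel_distr_plus)
  also have "\<dots> = (LINT x|lborel. h (c + x))"
    using assms by (intro integral_distr) auto
  finally show ?thesis by (simp add: add.commute)
qed

text \<open>By translation invariance the difference quotients of h have integral 0, and they
  converge to h'. The mean value theorem bounds them by the maximum of |h'|; steps of size at most 1
  keep their supports in the ball of radius R + norm b.\<close>

lemma integral_dirderiv_eq_0:
  fixes h h' :: "'a::euclidean_space \<Rightarrow> real"
  assumes der: "\<And>x. ((\<lambda>t. h (x + t *\<^sub>R b)) has_real_derivative h' x) (at 0)"
    and cont: "continuous_on UNIV h" "continuous_on UNIV h'"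
    and supp: "\<And>x. norm x > R \<Longrightarrow> h x = 0" "\<And>x. norm x > R \<Longrightarrow> h' x = 0" and R: "R \<ge> 0"
  shows "(LINT x|lborel. h' x) = 0"
proof -
  have "compact (h' ` cball 0 R)"
    by (intro compact_continuous_image continuous_on_subset[OF cont(2)]) auto
  then obtain K where K: "\<And>y. y \<in> h' ` cball 0 R \<Longrightarrow> norm y \<le> K"
    using compact_imp_bounded bounded_iff by metis
  have K0: "K \<ge> 0"
    using K[of "h' 0"] R by (smt (verit) image_eqI mem_cball_0 norm_ge_zero norm_zero)
  have bound: "\<bar>h' x\<bar> \<le> K" for x
    using K[of "h' x"] K0 supp(2)[of x] by (cases "norm x \<le> R") auto
  have der': "((\<lambda>t. h (x + t *\<^sub>R b)) has_real_derivative h' (x + t *\<^sub>R b)) (at t)" for x t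
    using der[of "x + t *\<^sub>R b"] DERIV_shift[of "\<lambda>t. h (x + t *\<^sub>R b)" _ 0 t]
    by (simp add: algebra_simps)
  define \<tau> where "\<tau> n = inverse (real (Suc n))" for n
  have \<tau>: "\<tau> n > 0" "\<tau> n \<le> 1" for n
    by (simp_all add: \<tau>_def inverse_le_1_iff)
  define q where "q n x = (h (x + \<tau> n *\<^sub>R b) - h x) / \<tau> n" for n x
  have meas: "h \<in> borel_measurable borel" "h' \<in> borel_measurable borel"
    using cont by (auto intro: borel_measurable_continuous_onI)
  have int: "integrable lborel h"
    using cont(1) supp(1) by (rule integrable_continuous_bounded_support)
  have int': "integrable lborel (\<lambda>x. h (x + c))" for c
  proof (rule integrable_continuous_bounded_support)
    show "continuous_on UNIV (\<lambda>x. h (x + c))"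
      by (rule continuous_on_compose2[OF cont(1)]) (auto intro!: continuous_intros)
    show "h (x + c) = 0" if "norm x > R + norm c" for x
      by (rule supp(1)) (use that norm_triangle_ineq2[of x "- c"] in auto)
  qed
  have "(\<lambda>n. LINT x|lborel. q n x) \<longlonglongrightarrow> (LINT x|lborel. h' x)"
  proof (rule integral_dominated_convergence)
    show "integrable lborel (\<lambda>x. indicator (cball (0::'a) (R + norm b)) x *\<^sub>R K)"
      by (rule borel_integrable_compact) auto
    show "AE x in lborel. (\<lambda>n. q n x) \<longlonglongrightarrow> h' x"
    proof (rule AE_I2)
      fix x
      have "((\<lambda>t. (h (x + t *\<^sub>R b) - h x) / t) \<longlongrightarrow> h' x) (at 0)"
        using der[of x] by (simp add: has_field_derivative_iff)
      moreover have "filterlim \<tau> (at 0) sequentially"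
        unfolding \<tau>_def by (intro filterlim_atI LIMSEQ_inverse_real_of_nat) auto
      ultimately show "(\<lambda>n. q n x) \<longlonglongrightarrow> h' x"
        unfolding q_def by (rule filterlim_compose)
    qed
    show "AE x in lborel. norm (q n x) \<le> indicator (cball (0::'a) (R + norm b)) x *\<^sub>R K" for n
    proof (rule AE_I2)
      fix x
      have "\<exists>z. z > 0 \<and> z < \<tau> n \<and> h (x + \<tau> n *\<^sub>R b) - h (x + 0 *\<^sub>R b) = (\<tau> n - 0) * h' (x + z *\<^sub>R b)"
        by (rule MVT2[OF \<tau>(1)]) (use der' in auto)
      then obtain z where z: "h (x + \<tau> n *\<^sub>R b) - h x = \<tau> n * h' (x + z *\<^sub>R b)"
        by auto
      have "norm (q n x) \<le> K"
        using bound \<tau>(1)[of n] by (simp add: q_def z)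
      moreover have "q n x = 0" if "norm x > R + norm b"
      proof -
        have "norm (\<tau> n *\<^sub>R b) \<le> norm b" using \<tau>[of n] by (simp add: mult_left_le_one_le)
        then have "norm (x + \<tau> n *\<^sub>R b) > R"
          using that norm_triangle_ineq2[of x "- (\<tau> n *\<^sub>R b)"] by simp
        moreover have "norm x > R" using that norm_ge_zero[of b] by linarith
        ultimately show ?thesis by (simp add: q_def supp(1))
      qed
      ultimately show "norm (q n x) \<le> indicator (cball (0::'a) (R + norm b)) x *\<^sub>R K"
        by (auto simp: indicator_def not_le)
    qed
    show "(\<lambda>x. q n x) \<in> borel_measurable lborel" for n
      using int int'[of "\<tau> n *\<^sub>R b"] unfolding q_def by (auto dest!: borel_measurable_integrable)
    show "h' \<in> borel_measurable lborel" using meas by simp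
  qed
  moreover have "(LINT x|lborel. q n x) = 0" for n
  proof -
    have "(LINT x|lborel. q n x) = ((LINT x|lborel. h (x + \<tau> n *\<^sub>R b)) - (LINT x|lborel. h x)) / \<tau> n"
      unfolding q_def using int int' by simp
    then show ?thesis by (simp add: integral_translate[OF meas(1)])
  qed
  ultimately show ?thesis using LIMSEQ_unique[of "\<lambda>n. 0::real"] by simp
qed

text \<open>This is the reason for the square in \<open>cutoff\<close>: the positive part alone has
  a kink at 0, its square is C^1.\<close>

lemma has_real_derivative_max_sq:
  "((\<lambda>r::real. (max 0 r)\<^sup>2) has_real_derivative 2 * max 0 r) (at r)"
proof -
  consider "r > 0" | "r < 0" | "r = 0" by linarith
  then show ?thesis
  proof cases
    case 1
    have "((\<lambda>r::real. r\<^sup>2) has_real_derivative 2 * max 0 r) (at r)"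
      using 1 by (auto intro!: derivative_eq_intros)
    moreover have "\<forall>\<^sub>F s in nhds r. (max 0 s)\<^sup>2 = s\<^sup>2"
      using eventually_nhds_in_open[of "{0<..}" r] 1 by (auto elim!: eventually_mono)
    ultimately show ?thesis using DERIV_cong_ev[of r r] by fast
  next
    case 2
    have "((\<lambda>r::real. 0) has_real_derivative 2 * max 0 r) (at r)"
      using 2 by (auto intro!: derivative_eq_intros)
    moreover have "\<forall>\<^sub>F s in nhds r. (max 0 s)\<^sup>2 = 0"
      using eventually_nhds_in_open[of "{..<0}" r] 2 by (auto elim!: eventually_mono)
    ultimately show ?thesis using DERIV_cong_ev[of r r] by fast
  next
    case 3
    have "((\<lambda>h::real. (max 0 h)\<^sup>2 / h) \<longlongrightarrow> 0) (at 0)"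
    proof (rule Lim_null_comparison)
      show "\<forall>\<^sub>F h::real in at 0. norm ((max 0 h)\<^sup>2 / h) \<le> \<bar>h\<bar>"
        by (rule always_eventually) (auto simp: max_def power2_eq_square)
      show "((\<lambda>h::real. \<bar>h\<bar>) \<longlongrightarrow> 0) (at 0)"
        using tendsto_rabs[OF tendsto_ident_at[of "0::real" UNIV]] by simp
    qed
    then show ?thesis using 3 by (simp add: has_field_derivative_iff)
  qed
qed

text \<open>A \<open>C\<^sup>1\<close> radial weight supported on the annulus \<open>1 \<le> |x| \<le> 2\<close>; averaging degree-0
  homogeneous functions against it replaces integration over the sphere.\<close>

definition cutoff :: "'a::euclidean_space \<Rightarrow> real" where
  "cutoff x = (max 0 ((x \<bullet> x - 1) * (4 - x \<bullet> x)))\<^sup>2"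

text \<open>The gradient of \<open>cutoff\<close> is \<open>dcutoff x\<close> times the position
  vector. The factor 5 - 2 r is the derivative of (r - 1)(4 - r) in r = x \<bullet> x, and 4
  collects the factors 2 from the outer square and from differentiating x \<bullet> x.\<close>

definition dcutoff :: "'a::euclidean_space \<Rightarrow> real" where
  "dcutoff x = 4 * max 0 ((x \<bullet> x - 1) * (4 - x \<bullet> x)) * (5 - 2 * (x \<bullet> x))"

lemma cutoff_nonneg: "cutoff x \<ge> 0"
  by (simp add: cutoff_def)

lemma annulus_weight_nonpos:
  fixes x :: "'a::real_inner"
  assumes "norm x \<le> 1 \<or> norm x \<ge> 2"
  shows "(x \<bullet> x - 1) * (4 - x \<bullet> x) \<le> 0"
proof -
  have "norm x * norm x \<le> 1 * 1 \<or> norm x * norm x \<ge> 2 * 2"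
    using assms by (meson mult_mono norm_ge_zero zero_le_numeral zero_le_one)
  then show ?thesis
    by (auto simp: dot_square_norm power2_eq_square mult_le_0_iff)
qed

lemma cutoff_eq_0: "norm x \<le> 1 \<or> norm x \<ge> 2 \<Longrightarrow> cutoff x = 0"
  using annulus_weight_nonpos[of x] by (simp add: cutoff_def)

lemma dcutoff_eq_0: "norm x \<le> 1 \<or> norm x \<ge> 2 \<Longrightarrow> dcutoff x = 0"
  using annulus_weight_nonpos[of x] by (simp add: dcutoff_def)

lemma cutoff_pos:
  assumes "1 < norm x" "norm x < 2"
  shows "cutoff x > 0"
proof -
  have "1 < (norm x)\<^sup>2"
    using assms(1) by (simp add: one_less_power)
  moreover have "(norm x)\<^sup>2 < 2\<^sup>2"
    using assms(2) by (intro power_strict_mono) auto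
  ultimately have "(x \<bullet> x - 1) * (4 - x \<bullet> x) > 0"
    by (simp add: dot_square_norm)
  then show ?thesis
    unfolding cutoff_def by (intro zero_less_power) (simp only: less_max_iff_disj simp_thms)
qed

lemma continuous_on_cutoff: "continuous_on S cutoff" "continuous_on S dcutoff"
  unfolding cutoff_def dcutoff_def by (intro continuous_intros)+

lemma cutoff_dirderiv:
  "((\<lambda>t. cutoff (x + t *\<^sub>R b)) has_real_derivative dcutoff x * (x \<bullet> b)) (at 0)"
proof -
  let ?r = "\<lambda>t. ((x + t *\<^sub>R b) \<bullet> (x + t *\<^sub>R b) - 1) * (4 - (x + t *\<^sub>R b) \<bullet> (x + t *\<^sub>R b))"
  have eq: "?r = (\<lambda>t. ((x \<bullet> x + 2 * t * (x \<bullet> b) + t\<^sup>2 * (b \<bullet> b)) - 1) * (4 - (x \<bullet> x + 2 * t * (x \<bullet> b) + t\<^sup>2 * (b \<bullet> b))))"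
    by (auto simp: fun_eq_iff algebra_simps power2_eq_square inner_commute)
  have "(?r has_real_derivative 2 * (x \<bullet> b) * (5 - 2 * (x \<bullet> x))) (at 0)"
    unfolding eq by (auto intro!: derivative_eq_intros simp: algebra_simps)
  from DERIV_chain2[OF has_real_derivative_max_sq this]
  show ?thesis unfolding cutoff_def dcutoff_def by (simp add: algebra_simps)
qed

text \<open>As \<rho> vanishes on the closed unit ball, it absorbs any singularity of \<phi> at the
  origin. Continuity is glued from two open sets, the punctured space and the open unit
  ball.\<close>

lemma continuous_on_annular_mult:
  fixes \<rho> \<phi> :: "'a::euclidean_space \<Rightarrow> real"
  assumes "continuous_on UNIV \<rho>" and "\<And>x. norm x \<le> 1 \<Longrightarrow> \<rho> x = 0" and "continuous_on (- {0}) \<phi>"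
  shows "continuous_on UNIV (\<lambda>x. \<rho> x * \<phi> x)"
proof -
  have "continuous_on (- {0}) (\<lambda>x. \<rho> x * \<phi> x)"
    using assms by (intro continuous_on_mult continuous_on_subset[OF assms(1)]) auto
  moreover have "continuous_on (ball 0 1) (\<lambda>x. \<rho> x * \<phi> x)"
    using continuous_on_const[of "ball 0 1" 0] by (rule continuous_on_eq) (use assms(2) in auto)
  ultimately have "continuous_on (- {0} \<union> ball 0 1) (\<lambda>x. \<rho> x * \<phi> x)"
    by (intro continuous_on_open_Un) auto
  moreover have "- {0} \<union> ball 0 1 = (UNIV :: 'a set)" by auto
  ultimately show ?thesis by simp
qed

lemma has_derivative_dirderiv:
  fixes g :: "'a::real_normed_vector \<Rightarrow> real"
  assumes D: "(g has_derivative D) (at x)"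
  shows "((\<lambda>t. g (x + t *\<^sub>R b)) has_real_derivative D b) (at 0)"
proof -
  have "((\<lambda>t::real. x + t *\<^sub>R b) has_derivative (\<lambda>t. t *\<^sub>R b)) (at 0)"
    by (auto intro!: derivative_eq_intros)
  then have "((\<lambda>t. g (x + t *\<^sub>R b)) has_derivative (\<lambda>t. D (t *\<^sub>R b))) (at 0)"
    using has_derivative_compose[of "\<lambda>t. x + t *\<^sub>R b" "\<lambda>t. t *\<^sub>R b" 0 UNIV g D] D by simp
  moreover have "(\<lambda>t. D (t *\<^sub>R b)) = (*) (D b)"
    using linear_scale[OF has_derivative_linear[OF D]] by (auto simp: mult.commute)
  ultimately show ?thesis by (simp add: has_field_derivative_def)
qed

lemma dderiv_eqI:
  assumes "((\<lambda>t. f (x + t *\<^sub>R b)) has_real_derivative y) (at 0)"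
  shows "dderiv b f x = y"
  using assms unfolding dderiv_def by (rule DERIV_imp_deriv)

lemma dirderiv_dderiv:
  fixes g :: "'a::real_normed_vector \<Rightarrow> real"
  assumes "g differentiable (at x)"
  shows "((\<lambda>t. g (x + t *\<^sub>R b)) has_real_derivative dderiv b g x) (at 0)"
  using assms has_derivative_dirderiv dderiv_eqI unfolding differentiable_def by metis

lemma dderiv_eq_sum_dderiv:
  fixes g :: "'a::euclidean_space \<Rightarrow> real"
  assumes "g differentiable (at x)"
  shows "dderiv v g x = (\<Sum>b\<in>Basis. (v \<bullet> b) * dderiv b g x)"
proof -
  obtain D where D: "(g has_derivative D) (at x)" using assms by (auto simp: differentiable_def)
  have *: "dderiv w g x = D w" for w
    by (rule dderiv_eqI[OF has_derivative_dirderiv[OF D]])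
  have lin: "linear D" using D by (rule has_derivative_linear)
  have "D v = D (\<Sum>b\<in>Basis. (v \<bullet> b) *\<^sub>R b)" by (simp add: euclidean_representation)
  also have "\<dots> = (\<Sum>b\<in>Basis. (v \<bullet> b) * D b)"
    by (simp add: linear_sum[OF lin] linear_scale[OF lin])
  finally show ?thesis by (simp add: *)
qed

lemma eventually_dirline_nonzero:
  fixes x :: "'a::real_normed_vector"
  assumes "x \<noteq> 0"
  shows "\<forall>\<^sub>F t in nhds 0. x + t *\<^sub>R b \<noteq> 0"
proof -
  have "isCont (\<lambda>t. x + t *\<^sub>R b) 0" by (intro continuous_intros)
  then have "((\<lambda>t. x + t *\<^sub>R b) \<longlongrightarrow> x) (nhds 0)"
    by (simp add: continuous_within tendsto_nhds_iff)
  then show ?thesis using assms by (rule tendsto_imp_eventually_ne)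
qed

lemma dderiv_cong:
  fixes g h :: "'a::real_normed_vector \<Rightarrow> real"
  assumes "\<And>y. y \<noteq> 0 \<Longrightarrow> g y = h y" and "x \<noteq> 0"
  shows "dderiv b g x = dderiv b h x"
proof -
  have "\<forall>\<^sub>F t in nhds 0. g (x + t *\<^sub>R b) = h (x + t *\<^sub>R b)"
    using eventually_dirline_nonzero[OF assms(2)] by eventually_elim (rule assms(1))
  then show ?thesis unfolding dderiv_def by (rule deriv_cong_ev) simp
qed

lemma dderiv_scale:
  fixes \<phi> :: "'a::real_normed_vector \<Rightarrow> real"
  assumes "\<phi> differentiable (at x)" and "x \<noteq> 0" and "c > 0"
    and hom: "\<And>y. y \<noteq> 0 \<Longrightarrow> \<phi> (c *\<^sub>R y) = k * \<phi> y"
  shows "dderiv b \<phi> (c *\<^sub>R x) = k * dderiv b \<phi> x / c"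
proof -
  have "((\<lambda>t. \<phi> (x + (t / c) *\<^sub>R b)) has_real_derivative dderiv b \<phi> x * (1 / c)) (at 0)"
  proof (rule DERIV_chain2[of "\<lambda>t. \<phi> (x + t *\<^sub>R b)" "dderiv b \<phi> x" "\<lambda>t. t / c"])
    show "((\<lambda>t. \<phi> (x + t *\<^sub>R b)) has_real_derivative dderiv b \<phi> x) (at (0 / c))"
      using dirderiv_dderiv[OF assms(1)] by simp
    show "((\<lambda>t. t / c) has_real_derivative 1 / c) (at 0)"
      using \<open>c > 0\<close> by (auto intro!: derivative_eq_intros)
  qed
  then have 1: "((\<lambda>t. k * \<phi> (x + (t / c) *\<^sub>R b)) has_real_derivative k * (dderiv b \<phi> x * (1 / c))) (at 0)"
    by (rule DERIV_cmult)
  have "\<forall>\<^sub>F t in nhds 0. \<phi> (c *\<^sub>R x + t *\<^sub>R b) = k * \<phi> (x + (t / c) *\<^sub>R b)"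
    using eventually_dirline_nonzero[OF \<open>x \<noteq> 0\<close>, of "b /\<^sub>R c"]
  proof eventually_elim
    case (elim t)
    then have "x + (t / c) *\<^sub>R b \<noteq> 0" by (simp add: divide_inverse)
    moreover have "c *\<^sub>R (x + (t / c) *\<^sub>R b) = c *\<^sub>R x + t *\<^sub>R b"
      using \<open>c > 0\<close> by (simp add: scaleR_add_right)
    ultimately show ?case using hom by metis
  qed
  then have "deriv (\<lambda>t. \<phi> (c *\<^sub>R x + t *\<^sub>R b)) 0 = deriv (\<lambda>t. k * \<phi> (x + (t / c) *\<^sub>R b)) 0"
    by (rule deriv_cong_ev) simp
  also have "\<dots> = k * (dderiv b \<phi> x * (1 / c))"
    using 1 by (rule DERIV_imp_deriv)
  finally show ?thesis by (simp add: dderiv_def)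
qed

text \<open>Stand-in for C^2 functions on the sphere, seen through their degree-0 extensions. Among
  second derivatives the pure ones are listed, since these are the terms of \<open>eucl_lap\<close>;
  their continuity makes the divergence in Green's identity integrable.\<close>

definition hom0_C2 :: "('a::euclidean_space \<Rightarrow> real) \<Rightarrow> bool" where
  "hom0_C2 g \<longleftrightarrow> (\<forall>c>0. \<forall>x. g (c *\<^sub>R x) = g x) \<and> g differentiable_on (- {0}) \<and>
     (\<forall>b\<in>Basis. dderiv b g differentiable_on (- {0}) \<and> continuous_on (- {0}) (dderiv b (dderiv b g)))"

lemma differentiable_on_punctured:
  "g differentiable_on (- {0}) \<longleftrightarrow> (\<forall>x. x \<noteq> 0 \<longrightarrow> g differentiable (at x))"
  by (auto simp: differentiable_on_eq_differentiable_at[OF open_Compl[OF closed_singleton]])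

lemma hom0_C2D:
  assumes "hom0_C2 g"
  shows hom0_C2_scale: "c > 0 \<Longrightarrow> g (c *\<^sub>R x) = g x"
    and hom0_C2_diff: "x \<noteq> 0 \<Longrightarrow> g differentiable (at x)"
    and hom0_C2_diff2: "x \<noteq> 0 \<Longrightarrow> b \<in> Basis \<Longrightarrow> dderiv b g differentiable (at x)"
    and hom0_C2_cont: "continuous_on (- {0}) g"
    and hom0_C2_cont1: "b \<in> Basis \<Longrightarrow> continuous_on (- {0}) (dderiv b g)"
    and hom0_C2_cont2: "b \<in> Basis \<Longrightarrow> continuous_on (- {0}) (dderiv b (dderiv b g))"
  using assms unfolding hom0_C2_def differentiable_on_punctured
  by (auto intro!: differentiable_imp_continuous_on simp: differentiable_on_punctured)

lemma hom0_C2_euler: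
  assumes "hom0_C2 g" "x \<noteq> 0"
  shows "(\<Sum>b\<in>Basis. (x \<bullet> b) * dderiv b g x) = 0"
proof -
  have "\<forall>\<^sub>F t::real in nhds 0. t > -1"
    using eventually_nhds_in_open[of "{-1<..}" "0::real"] by (auto elim: eventually_mono)
  then have "\<forall>\<^sub>F t in nhds 0. g (x + t *\<^sub>R x) = g x"
  proof eventually_elim
    case (elim t)
    then show ?case using hom0_C2_scale[OF assms(1), of "1 + t" x] by (simp add: algebra_simps)
  qed
  then have "dderiv x g x = deriv (\<lambda>t. g x) 0"
    unfolding dderiv_def by (rule deriv_cong_ev) simp
  then show ?thesis
    using dderiv_eq_sum_dderiv[OF hom0_C2_diff[OF assms], of x] by simp
qed

lemma hom0_C2_lap_scale:
  assumes g: "hom0_C2 g" and x: "x \<noteq> 0" and c: "c > 0"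
  shows "eucl_lap g (c *\<^sub>R x) = eucl_lap g x / c\<^sup>2"
proof -
  have "dderiv b (dderiv b g) (c *\<^sub>R x) = dderiv b (dderiv b g) x / c\<^sup>2" if b: "b \<in> Basis" for b
  proof -
    have "dderiv b g (c *\<^sub>R y) = 1 / c * dderiv b g y" if "y \<noteq> 0" for y
      using dderiv_scale[OF hom0_C2_diff[OF g that] that c, of 1 b] hom0_C2_scale[OF g c] by simp
    then have "dderiv b (dderiv b g) (c *\<^sub>R x) = 1 / c * dderiv b (dderiv b g) x / c"
      by (rule dderiv_scale[OF hom0_C2_diff2[OF g x b] x c])
    then show ?thesis by (simp add: power2_eq_square)
  qed
  then show ?thesis by (simp add: eucl_lap_def sum_divide_distrib)
qed

text \<open>The field \<open>cutoff\<close> (g grad p - p grad g) has compact support, so its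
  divergence integrates to 0. As \<open>cutoff\<close> is radial, the term containing its gradient
  is a multiple of x \<bullet> (g grad p - p grad g), which vanishes by Euler's relation in degree
  0.\<close>

lemma green_cutoff:
  fixes g p :: "'a::euclidean_space \<Rightarrow> real"
  assumes g: "hom0_C2 g" and p: "hom0_C2 p"
  shows "(LINT x|lborel. cutoff x * (g x * eucl_lap p x - p x * eucl_lap g x)) = 0"
proof -
  define w where "w b x = g x * dderiv b p x - p x * dderiv b g x" for b x
  define w' where "w' b x = g x * dderiv b (dderiv b p) x - p x * dderiv b (dderiv b g) x" for b x
  define h where "h b x = cutoff x * w b x" for b x
  define h' where "h' b x = dcutoff x * ((x \<bullet> b) * w b x) + cutoff x * w' b x" for b x
  note cont = hom0_C2_cont[OF g] hom0_C2_cont[OF p] hom0_C2_cont1[OF g] hom0_C2_cont1[OF p]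
    hom0_C2_cont2[OF g] hom0_C2_cont2[OF p]
  have cw: "continuous_on (- {0}) (w b)" "continuous_on (- {0}) (w' b)" if "b \<in> Basis" for b
    unfolding w_def w'_def by (intro continuous_intros cont that)+
  have ch: "continuous_on UNIV (h b)" if "b \<in> Basis" for b
    unfolding h_def
    by (intro continuous_on_annular_mult continuous_on_cutoff cw that) (simp add: cutoff_eq_0)
  have ch': "continuous_on UNIV (h' b)" if "b \<in> Basis" for b
    unfolding h'_def
    by (intro continuous_on_add continuous_on_annular_mult continuous_on_cutoff cw that
        continuous_on_mult continuous_on_inner continuous_on_id continuous_on_const)
      (simp_all add: cutoff_eq_0 dcutoff_eq_0)
  have int: "integrable lborel (h' b)" if "b \<in> Basis" for b
    by (rule integrable_continuous_bounded_support[OF ch'[OF that], of 2])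
      (simp add: h'_def cutoff_eq_0 dcutoff_eq_0)
  have zero: "(LINT x|lborel. h' b x) = 0" if b: "b \<in> Basis" for b
  proof (rule integral_dirderiv_eq_0[where h = "h b" and b = b and R = 2])
    show "((\<lambda>t. h b (x + t *\<^sub>R b)) has_real_derivative h' b x) (at 0)" for x
    proof (cases "x = 0")
      case False
      note [derivative_intros] = dirderiv_dderiv[OF hom0_C2_diff[OF g False]] dirderiv_dderiv[OF hom0_C2_diff[OF p False]]
        dirderiv_dderiv[OF hom0_C2_diff2[OF g False b]] dirderiv_dderiv[OF hom0_C2_diff2[OF p False b]] cutoff_dirderiv
      show ?thesis
        unfolding h_def h'_def w_def w'_def
        by (rule derivative_eq_intros refl)+ (simp add: algebra_simps)
    next
      \<comment> \<open>At the origin g and p may be singular, but \<open>h b\<close> is 0 on the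
        whole open unit ball.\<close>
      case True
      have "isCont (\<lambda>t. x + t *\<^sub>R b) 0" by (intro continuous_intros)
      then have "((\<lambda>t. norm (x + t *\<^sub>R b)) \<longlongrightarrow> 0) (nhds 0)"
        using True by (intro tendsto_norm_zero) (simp add: continuous_within tendsto_nhds_iff)
      then have "\<forall>\<^sub>F t in nhds 0. norm (x + t *\<^sub>R b) < 1"
        by (rule order_tendstoD) simp
      then have "\<forall>\<^sub>F t in nhds 0. h b (x + t *\<^sub>R b) = 0"
        by eventually_elim (simp add: h_def cutoff_eq_0)
      moreover have "((\<lambda>t::real. 0) has_real_derivative h' b x) (at 0)"
        using True by (auto intro!: derivative_eq_intros simp: h'_def cutoff_eq_0 dcutoff_eq_0)
      ultimately show ?thesis using DERIV_cong_ev[of 0 0] by fast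
    qed
  qed (use ch ch' b in \<open>auto simp: h_def h'_def cutoff_eq_0 dcutoff_eq_0\<close>)
  have "(\<Sum>b\<in>Basis. h' b x) = cutoff x * (g x * eucl_lap p x - p x * eucl_lap g x)" for x
  proof (cases "x = 0")
    case True
    then show ?thesis by (simp add: h'_def cutoff_eq_0 dcutoff_eq_0)
  next
    case False
    have "(\<Sum>b\<in>Basis. (x \<bullet> b) * w b x)
      = g x * (\<Sum>b\<in>Basis. (x \<bullet> b) * dderiv b p x) - p x * (\<Sum>b\<in>Basis. (x \<bullet> b) * dderiv b g x)"
      by (simp add: w_def sum_distrib_left sum_subtractf[symmetric] algebra_simps)
    also have "\<dots> = 0"
      by (simp add: hom0_C2_euler[OF g False] hom0_C2_euler[OF p False])
    finally have "(\<Sum>b\<in>Basis. h' b x) = cutoff x * (\<Sum>b\<in>Basis. w' b x)"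
      by (simp add: h'_def sum.distrib sum_distrib_left[symmetric])
    also have "(\<Sum>b\<in>Basis. w' b x) = g x * eucl_lap p x - p x * eucl_lap g x"
      by (simp add: w'_def eucl_lap_def sum_distrib_left sum_subtractf)
    finally show ?thesis .
  qed
  then have "(LINT x|lborel. cutoff x * (g x * eucl_lap p x - p x * eucl_lap g x))
    = (LINT x|lborel. (\<Sum>b\<in>Basis. h' b x))" by simp
  also have "\<dots> = (\<Sum>b\<in>Basis. (LINT x|lborel. h' b x))"
    using int by (intro Bochner_Integration.integral_sum)
  finally show ?thesis using zero by simp
qed

section \<open>Averages of degree-0 functions over the annulus\<close>

text \<open>The factor 1 / (x \<bullet> x) accounts for the Laplacian of a degree-0 function having
  degree -2: its value at x / |x| is (x \<bullet> x) times its value at x.\<close>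

definition annular_avg :: "('a::euclidean_space \<Rightarrow> real) \<Rightarrow> real" where
  "annular_avg g = (LINT x|lborel. cutoff x / (x \<bullet> x) * g x)"

lemma continuous_on_annular_weight: "continuous_on UNIV (\<lambda>x::'a::euclidean_space. cutoff x / (x \<bullet> x))"
proof -
  have "continuous_on UNIV (\<lambda>x::'a. cutoff x * inverse (x \<bullet> x))"
    by (intro continuous_on_annular_mult continuous_on_cutoff continuous_intros) (auto simp: cutoff_eq_0)
  then show ?thesis by (simp add: divide_inverse)
qed

lemma annular_avg_integrable:
  fixes g :: "'a::euclidean_space \<Rightarrow> real"
  assumes "continuous_on (- {0}) g"
  shows "integrable lborel (\<lambda>x. cutoff x / (x \<bullet> x) * g x)"
proof (rule integrable_continuous_bounded_support)
  show "continuous_on UNIV (\<lambda>x. cutoff x / (x \<bullet> x) * g x)"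
    by (intro continuous_on_annular_mult continuous_on_annular_weight assms) (simp add: cutoff_eq_0)
  show "cutoff x / (x \<bullet> x) * g x = 0" if "norm x > 2" for x
    using that by (simp add: cutoff_eq_0)
qed

lemma annular_avg_add:
  assumes "continuous_on (- {0}) g" "continuous_on (- {0}) h"
  shows "annular_avg (\<lambda>x. g x + h x) = annular_avg g + annular_avg h"
  using annular_avg_integrable[OF assms(1)] annular_avg_integrable[OF assms(2)]
  by (simp add: annular_avg_def distrib_left)

lemma annular_avg_cmult: "annular_avg (\<lambda>x. c * g x) = c * annular_avg g"
proof -
  have "annular_avg (\<lambda>x. c * g x) = (LINT x|lborel. c * (cutoff x / (x \<bullet> x) * g x))"
    unfolding annular_avg_def by (simp only: mult.left_commute)
  then show ?thesis by (simp only: annular_avg_def integral_mult_right_zero)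
qed

lemma annular_avg_cong:
  assumes "\<And>x. x \<noteq> 0 \<Longrightarrow> g x = h x"
  shows "annular_avg g = annular_avg h"
  unfolding annular_avg_def
proof (rule Bochner_Integration.integral_cong)
  show "cutoff x / (x \<bullet> x) * g x = cutoff x / (x \<bullet> x) * h x" for x
    using assms[of x] by (cases "x = 0") auto
qed simp

lemma annular_avg_mono:
  assumes "continuous_on (- {0}) g" "continuous_on (- {0}) h" "\<And>x. x \<noteq> 0 \<Longrightarrow> g x \<le> h x"
  shows "annular_avg g \<le> annular_avg h"
  unfolding annular_avg_def
proof (rule integral_mono[OF annular_avg_integrable[OF assms(1)] annular_avg_integrable[OF assms(2)]])
  show "cutoff x / (x \<bullet> x) * g x \<le> cutoff x / (x \<bullet> x) * h x" for x
    using assms(3)[of x] by (cases "x = 0") (auto simp del: times_divide_eq_left intro!: mult_left_mono divide_nonneg_nonneg cutoff_nonneg)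
qed

text \<open>The integrand vanishes almost everywhere; by homogeneity and continuity a nonzero value
  of g would produce a nonempty open null set inside the annulus.\<close>

lemma annular_avg_eq_0D:
  fixes g :: "'a::euclidean_space \<Rightarrow> real"
  assumes cont: "continuous_on (- {0}) g" and nonneg: "\<And>x. x \<noteq> 0 \<Longrightarrow> g x \<ge> 0"
    and hom: "\<And>c x. c > 0 \<Longrightarrow> g (c *\<^sub>R x) = g x" and "annular_avg g = 0" and "x \<noteq> 0"
  shows "g x = 0"
proof (rule ccontr)
  assume gx: "g x \<noteq> 0"
  have "AE x in lborel. cutoff x / (x \<bullet> x) * g x = 0"
    using assms(4) unfolding annular_avg_def
  proof (subst (asm) integral_nonneg_eq_0_iff_AE[OF annular_avg_integrable[OF cont]])
    show "AE x in lborel. 0 \<le> cutoff x / (x \<bullet> x) * g x"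
    proof (rule AE_I2)
      show "0 \<le> cutoff x / (x \<bullet> x) * g x" for x
        using nonneg[of x] cutoff_nonneg[of x] by (cases "x = 0") auto
    qed
  qed
  note AE = this
  define U where "U = {x. 1 < norm x \<and> norm x < 2} \<inter> {x \<in> - {0}. g x \<in> - {0}}"
  have "open {x::'a. 1 < norm x}" "open {x::'a. norm x < 2}"
    by (intro open_Collect_less continuous_intros)+
  then have "open {x::'a. 1 < norm x \<and> norm x < 2}"
    by (rule open_Collect_conj)
  moreover have "open {x \<in> - {0}. g x \<in> - {0}}"
    using continuous_open_preimage[OF cont, of "- {0}"] by (auto simp: vimage_def Int_def)
  ultimately have "open U" unfolding U_def by blast
  \<comment> \<open>The ray through x is met at radius 3/2, where the weight is positive.\<close>
  moreover have "(3/2 / norm x) *\<^sub>R x \<in> U"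
    using gx \<open>x \<noteq> 0\<close> hom[of "3/2 / norm x" x] by (simp add: U_def)
  moreover have "U \<subseteq> {x. cutoff x / (x \<bullet> x) * g x \<noteq> 0}"
    unfolding U_def using cutoff_pos by force
  ultimately have "AE x in lborel. x \<notin> U"
    using AE by (auto elim!: eventually_mono)
  then have "U \<in> null_sets lborel"
    using \<open>open U\<close> by (subst (asm) AE_iff_null_sets[symmetric]) auto
  then have "negligible U"
    by (simp add: negligible_iff_null_sets null_sets_completionI)
  then show False
    using open_not_negligible[OF \<open>open U\<close>] \<open>(3/2 / norm x) *\<^sub>R x \<in> U\<close> by blast
qed

lemma green_annular:
  fixes g p :: "'a::euclidean_space \<Rightarrow> real"
  assumes g: "hom0_C2 g" and p: "hom0_C2 p"
  shows "annular_avg (\<lambda>x. g x * eucl_lap p (x /\<^sub>R norm x) - p x * eucl_lap g (x /\<^sub>R norm x)) = 0"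
proof -
  have lap: "eucl_lap q (x /\<^sub>R norm x) = (x \<bullet> x) * eucl_lap q x" if "hom0_C2 q" "x \<noteq> 0" for q :: "'a \<Rightarrow> real" and x
    using hom0_C2_lap_scale[OF that, of "inverse (norm x)"] that(2)
    by (simp add: divide_inverse power2_norm_eq_inner[symmetric] power2_eq_square mult.commute)
  have "cutoff x / (x \<bullet> x) * (g x * eucl_lap p (x /\<^sub>R norm x) - p x * eucl_lap g (x /\<^sub>R norm x))
    = cutoff x * (g x * eucl_lap p x - p x * eucl_lap g x)" for x
  proof (cases "x = 0")
    case True
    then show ?thesis by (simp add: cutoff_eq_0)
  next
    case False
    then have "x \<bullet> x \<noteq> 0" by simp
    then show ?thesis unfolding lap[OF g False] lap[OF p False] by (simp add: divide_simps algebra_simps)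
  qed
  then show ?thesis unfolding annular_avg_def by (simp add: green_cutoff[OF g p])
qed

section \<open>Cartan--Muenzner polynomials and zonal functions\<close>

text \<open>The algebra generated by the coordinates and \<open>1/|x|\<close> is closed under partial derivatives,
  which yields all smoothness facts about degree-0 extensions of polynomials.\<close>

inductive radial_alg :: "('a::euclidean_space \<Rightarrow> real) \<Rightarrow> bool" where
  const: "radial_alg (\<lambda>x. c)"
| inner: "radial_alg (\<lambda>x. x \<bullet> b)"
| inv: "radial_alg (\<lambda>x. inverse (norm x))"
| add: "radial_alg f \<Longrightarrow> radial_alg g \<Longrightarrow> radial_alg (\<lambda>x. f x + g x)"
| mult: "radial_alg f \<Longrightarrow> radial_alg g \<Longrightarrow> radial_alg (\<lambda>x. f x * g x)"

lemma radial_alg_power: "radial_alg f \<Longrightarrow> radial_alg (\<lambda>x. f x ^ k)"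
  by (induction k) (auto intro: radial_alg.const radial_alg.mult)

lemma radial_alg_sum: "(\<And>i. i \<in> I \<Longrightarrow> radial_alg (f i)) \<Longrightarrow> radial_alg (\<lambda>x. \<Sum>i\<in>I. f i x)"
  by (induction I rule: infinite_finite_induct) (auto intro: radial_alg.const radial_alg.add)

lemma radial_alg_prod: "(\<And>i. i \<in> I \<Longrightarrow> radial_alg (f i)) \<Longrightarrow> radial_alg (\<lambda>x. \<Prod>i\<in>I. f i x)"
  by (induction I rule: infinite_finite_induct) (auto intro: radial_alg.const radial_alg.mult)

lemma radial_alg_poly: "radial_alg f \<Longrightarrow> radial_alg (\<lambda>x. poly Q (f x))"
  by (induction Q) (auto intro: radial_alg.const radial_alg.add radial_alg.mult)

lemma inverse_norm_dirderiv:
  fixes x :: "'a::euclidean_space"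
  assumes "x \<noteq> 0"
  shows "((\<lambda>t. inverse (norm (x + t *\<^sub>R b)) ^ k) has_real_derivative
           - (real k * inverse (norm x) ^ (k + 2) * (x \<bullet> b))) (at 0)"
proof -
  have n: "((\<lambda>t. norm (x + t *\<^sub>R b)) has_real_derivative (x \<bullet> b) / norm x) (at 0)"
  proof -
    have eq: "(\<lambda>t. norm (x + t *\<^sub>R b)) = (\<lambda>t. sqrt (x \<bullet> x + 2 * t * (x \<bullet> b) + t\<^sup>2 * (b \<bullet> b)))"
    proof
      fix t
      have "(x + t *\<^sub>R b) \<bullet> (x + t *\<^sub>R b) = x \<bullet> x + 2 * t * (x \<bullet> b) + t\<^sup>2 * (b \<bullet> b)"
        by (simp add: inner_add_left inner_add_right inner_commute[of b x] power2_eq_square distrib_left)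
      then show "norm (x + t *\<^sub>R b) = sqrt (x \<bullet> x + 2 * t * (x \<bullet> b) + t\<^sup>2 * (b \<bullet> b))"
        by (simp only: norm_eq_sqrt_inner)
    qed
    have inner: "((\<lambda>t. x \<bullet> x + 2 * t * (x \<bullet> b) + t\<^sup>2 * (b \<bullet> b)) has_real_derivative 2 * (x \<bullet> b)) (at 0)"
      by (auto intro!: derivative_eq_intros)
    have "(sqrt has_real_derivative inverse (norm x) / 2) (at (x \<bullet> x + 2 * 0 * (x \<bullet> b) + 0\<^sup>2 * (b \<bullet> b)))"
      using DERIV_real_sqrt[of "x \<bullet> x"] assms by (simp add: norm_eq_sqrt_inner)
    from DERIV_chain2[OF this inner] have "((\<lambda>t. sqrt (x \<bullet> x + 2 * t * (x \<bullet> b) + t\<^sup>2 * (b \<bullet> b)))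
        has_real_derivative inverse (norm x) / 2 * (2 * (x \<bullet> b))) (at 0)"
      .
    then show ?thesis unfolding eq by (rule DERIV_cong) (use assms in \<open>simp add: field_simps\<close>)
  qed
  have "((\<lambda>t. inverse (norm (x + t *\<^sub>R b)) ^ k) has_real_derivative
      real k * (- (inverse (norm x) * ((x \<bullet> b) / norm x) * inverse (norm x)) * inverse (norm x) ^ (k - 1))) (at 0)"
    using DERIV_power[OF DERIV_inverse'[OF n], of k] assms by simp
  moreover have "real k * (- (inverse (norm x) * ((x \<bullet> b) / norm x) * inverse (norm x)) * inverse (norm x) ^ (k - 1))
    = - (real k * inverse (norm x) ^ (k + 2) * (x \<bullet> b))"
    by (cases k) (simp_all add: divide_inverse)
  ultimately show ?thesis by simp
qed

lemma radial_alg_dirderiv: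
  assumes "radial_alg f"
  shows "\<exists>g. radial_alg g \<and> (\<forall>x. x \<noteq> 0 \<longrightarrow> ((\<lambda>t. f (x + t *\<^sub>R b)) has_real_derivative g x) (at 0))"
  using assms
proof induction
  case (const c)
  show ?case by (rule exI[of _ "\<lambda>x. 0"]) (simp add: radial_alg.const)
next
  case (inner c)
  have "((\<lambda>t. (x + t *\<^sub>R b) \<bullet> c) has_real_derivative b \<bullet> c) (at 0)" for x
    by (auto intro!: derivative_eq_intros simp: inner_add_left)
  then show ?case by (intro exI[of _ "\<lambda>x. b \<bullet> c"] conjI allI impI radial_alg.const)
next
  case inv
  have "((\<lambda>t. inverse (norm (x + t *\<^sub>R b))) has_real_derivative (- 1) * (inverse (norm x) ^ 3 * (x \<bullet> b))) (at 0)"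
    if "x \<noteq> 0" for x :: 'a
    using inverse_norm_dirderiv[OF that, of b 1] by (simp add: power3_eq_cube mult.assoc)
  then show ?case
    by (intro exI[of _ "\<lambda>x. (- 1) * (inverse (norm x) ^ 3 * (x \<bullet> b))"] conjI allI impI
        radial_alg.mult radial_alg.const radial_alg_power radial_alg.inner radial_alg.inv)
next
  case (add f g)
  obtain f' where f': "radial_alg f'"
    "\<And>x. x \<noteq> 0 \<Longrightarrow> ((\<lambda>t. f (x + t *\<^sub>R b)) has_real_derivative f' x) (at 0)" using add.IH(1) by metis
  obtain g' where g': "radial_alg g'"
    "\<And>x. x \<noteq> 0 \<Longrightarrow> ((\<lambda>t. g (x + t *\<^sub>R b)) has_real_derivative g' x) (at 0)" using add.IH(2) by metis
  show ?case
    by (intro exI[of _ "\<lambda>x. f' x + g' x"] conjI allI impI radial_alg.add DERIV_add f' g')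
next
  case (mult f g)
  obtain f' where f': "radial_alg f'"
    "\<And>x. x \<noteq> 0 \<Longrightarrow> ((\<lambda>t. f (x + t *\<^sub>R b)) has_real_derivative f' x) (at 0)" using mult.IH(1) by metis
  obtain g' where g': "radial_alg g'"
    "\<And>x. x \<noteq> 0 \<Longrightarrow> ((\<lambda>t. g (x + t *\<^sub>R b)) has_real_derivative g' x) (at 0)" using mult.IH(2) by metis
  have "((\<lambda>t. f (x + t *\<^sub>R b) * g (x + t *\<^sub>R b)) has_real_derivative f' x * g x + g' x * f x) (at 0)"
    if "x \<noteq> 0" for x
    using DERIV_mult[OF f'(2)[OF that] g'(2)[OF that]] by simp
  then show ?case
    by (intro exI[of _ "\<lambda>x. f' x * g x + g' x * f x"] conjI allI impI
        radial_alg.add radial_alg.mult f' g' mult.hyps)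
qed

lemma radial_alg_differentiable:
  fixes x :: "'a::euclidean_space"
  assumes "radial_alg f" "x \<noteq> 0"
  shows "f differentiable (at x)"
  using assms
proof induction
  case (inner b)
  show ?case by (auto simp: differentiable_def intro!: exI derivative_eq_intros)
next
  case inv
  then show ?case by (auto intro!: differentiable_inverse differentiable_norm_at)
qed (auto intro: differentiable_add differentiable_mult)

lemma radial_alg_dderiv:
  assumes "radial_alg f"
  obtains g where "radial_alg g" "\<And>x. x \<noteq> 0 \<Longrightarrow> dderiv b f x = g x"
  using radial_alg_dirderiv[OF assms, of b] dderiv_eqI by metis

lemma radial_alg_continuous_on:
  assumes "radial_alg f"
  shows "continuous_on (- {0}) f"
  using radial_alg_differentiable[OF assms] differentiable_on_punctured[of f]
  by (auto intro: differentiable_imp_continuous_on)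

lemma differentiable_on_punctured_cong:
  assumes "g differentiable_on (- {0})" and "\<And>x. x \<noteq> 0 \<Longrightarrow> f x = g x"
  shows "f differentiable_on (- {0})"
proof -
  have "f differentiable (at x)" if x: "x \<noteq> 0" for x
  proof -
    obtain D where "(g has_derivative D) (at x)"
      using assms(1) x by (auto simp: differentiable_on_punctured differentiable_def)
    then have "(f has_derivative D) (at x)"
      by (rule has_derivative_transform_within_open[of _ _ _ _ "- {0}"]) (use x assms(2) in auto)
    then show ?thesis by (auto simp: differentiable_def)
  qed
  then show ?thesis by (simp add: differentiable_on_punctured)
qed

lemma radial_alg_hom0_C2:
  fixes f :: "'a::euclidean_space \<Rightarrow> real"
  assumes f: "radial_alg f" and hom: "\<And>c x. c > 0 \<Longrightarrow> f (c *\<^sub>R x) = f x"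
  shows "hom0_C2 f"
proof -
  have "dderiv b f differentiable_on (- {0}) \<and> continuous_on (- {0}) (dderiv b (dderiv b f))" for b
  proof -
    obtain g where g: "radial_alg g" "\<And>x. x \<noteq> 0 \<Longrightarrow> dderiv b f x = g x"
      using radial_alg_dderiv[OF f, of b] by blast
    obtain h where h: "radial_alg h" "\<And>x. x \<noteq> 0 \<Longrightarrow> dderiv b g x = h x"
      using radial_alg_dderiv[OF g(1), of b] by blast
    have "g differentiable_on (- {0})"
      using radial_alg_differentiable[OF g(1)] by (simp add: differentiable_on_punctured)
    then have "dderiv b f differentiable_on (- {0})"
      by (rule differentiable_on_punctured_cong) (simp add: g(2))
    moreover have "continuous_on (- {0}) (dderiv b (dderiv b f))"
    proof (rule continuous_on_eq[OF radial_alg_continuous_on[OF h(1)]])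
      show "h x = dderiv b (dderiv b f) x" if "x \<in> - {0}" for x
        using dderiv_cong[of "dderiv b f" g x b] g(2) h(2) that by simp
    qed
    ultimately show ?thesis by blast
  qed
  then show ?thesis
    using radial_alg_differentiable[OF f] hom by (simp add: hom0_C2_def differentiable_on_punctured)
qed

lemma homog_poly_radial_alg:
  assumes "homog_poly d F"
  shows "radial_alg F"
proof -
  obtain C where F: "\<And>x. F x = (\<Sum>\<alpha>\<in>{\<alpha>. C \<alpha> \<noteq> 0}. C \<alpha> * (\<Prod>i\<in>UNIV. (x $ i) ^ (\<alpha> i)))"
    using assms unfolding homog_poly_def by blast
  have *: "(\<lambda>x. x $ i) = (\<lambda>x. x \<bullet> axis i (1::real))" for i :: 'a
    by (simp add: inner_axis)
  have "radial_alg (\<lambda>x. x $ i)" for i :: 'a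
    unfolding * by (rule radial_alg.inner)
  then have "radial_alg (\<lambda>x. \<Sum>\<alpha>\<in>{\<alpha>. C \<alpha> \<noteq> 0}. C \<alpha> * (\<Prod>i\<in>UNIV. (x $ i) ^ (\<alpha> i)))"
    by (intro radial_alg_sum radial_alg_prod radial_alg_power radial_alg.mult radial_alg.const)
  then show ?thesis by (simp add: F[abs_def])
qed

lemma homog_poly_scale:
  assumes "homog_poly d F"
  shows "F (c *\<^sub>R x) = c ^ d * F x"
proof -
  obtain C where d: "\<And>\<alpha>. C \<alpha> \<noteq> 0 \<Longrightarrow> (\<Sum>i\<in>UNIV. \<alpha> i) = d"
    and F: "\<And>x. F x = (\<Sum>\<alpha>\<in>{\<alpha>. C \<alpha> \<noteq> 0}. C \<alpha> * (\<Prod>i\<in>UNIV. (x $ i) ^ (\<alpha> i)))"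
    using assms unfolding homog_poly_def by blast
  have "(\<Prod>i\<in>UNIV. ((c *\<^sub>R x) $ i) ^ \<alpha> i) = c ^ d * (\<Prod>i\<in>UNIV. (x $ i) ^ \<alpha> i)" if "C \<alpha> \<noteq> 0" for \<alpha>
    by (simp add: power_mult_distrib prod.distrib power_sum[symmetric] d[OF that])
  then show ?thesis
    by (simp add: F sum_distrib_left mult.left_commute)
qed

section \<open>Zonal functions of a Cartan-Muenzner polynomial\<close>

text \<open>The parameters a and g are forced by matching the spherical Laplacian in the variable y
  with d^2 times the hypergeometric operator. With \<alpha> = g - 1 and \<beta> = a - g this gives
  \<alpha> - \<beta> = -c/2.\<close>

locale muenzner =
  fixes F :: "'a::euclidean_space \<Rightarrow> real" and d :: nat and c a g :: real
  assumes d: "d \<ge> 1"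
    and F_alg: "radial_alg F"
    and F_hom: "\<And>r x. F (r *\<^sub>R x) = r ^ d * F x"
    and F_grad: "\<And>x. norm x = 1 \<Longrightarrow> grad_sq F x = (real d)\<^sup>2"
    and F_lap: "\<And>x. norm x = 1 \<Longrightarrow> eucl_lap F x = c / 2 * (real d)\<^sup>2"
    and dim: "DIM('a) \<ge> 3"
    and c: "c \<le> 0"
    and a_def: "a = (real DIM('a) - 2) / real d"
    and g_def: "g = (a + 1) / 2 - c / 4"
begin

lemma F_dirderiv:
  assumes "x \<noteq> 0"
  shows "((\<lambda>t. F (x + t *\<^sub>R b)) has_real_derivative dderiv b F x) (at 0)"
  by (rule dirderiv_dderiv[OF radial_alg_differentiable[OF F_alg assms]])

lemma F_dirderiv2:
  assumes "x \<noteq> 0"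
  shows "((\<lambda>t. dderiv b F (x + t *\<^sub>R b)) has_real_derivative dderiv b (dderiv b F) x) (at 0)"
proof -
  obtain g where g: "radial_alg g" "\<And>x. x \<noteq> 0 \<Longrightarrow> dderiv b F x = g x"
    using radial_alg_dderiv[OF F_alg, of b] by blast
  have "g differentiable_on (- {0})"
    using radial_alg_differentiable[OF g(1)] by (simp add: differentiable_on_punctured)
  then have "dderiv b F differentiable_on (- {0})"
    by (rule differentiable_on_punctured_cong) (simp add: g(2))
  then show ?thesis using assms by (intro dirderiv_dderiv) (simp add: differentiable_on_punctured)
qed

lemma F_euler:
  assumes "x \<noteq> 0"
  shows "(\<Sum>b\<in>Basis. (x \<bullet> b) * dderiv b F x) = real d * F x"
proof -
  have eq: "(\<lambda>t. F (x + t *\<^sub>R x)) = (\<lambda>t. (1 + t) ^ d * F x)"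
  proof
    show "F (x + t *\<^sub>R x) = (1 + t) ^ d * F x" for t
      using F_hom[of "1 + t" x] by (simp add: scaleR_add_left)
  qed
  have "dderiv x F x = real d * F x"
    by (rule dderiv_eqI) (unfold eq, auto intro!: derivative_eq_intros)
  then show ?thesis
    using dderiv_eq_sum_dderiv[OF radial_alg_differentiable[OF F_alg assms], of x] by simp
qed

lemma sum_inner_sq:
  fixes x :: 'a
  assumes "norm x = 1"
  shows "(\<Sum>b\<in>Basis. (x \<bullet> b)\<^sup>2) = 1"
  using assms euclidean_inner[of x x] by (simp add: dot_square_norm power2_eq_square)

text \<open>By Euler's relation the radial derivative of F at a unit vector is d F, so the summands
  are the squared components of the tangential gradient. Nonnegativity of the sum later gives |F|
  \<le> 1 on the sphere.\<close>

lemma tangential_grad_sq: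
  assumes x: "norm x = 1"
  shows "(\<Sum>b\<in>Basis. (dderiv b F x - real d * F x * (x \<bullet> b))\<^sup>2) = (real d)\<^sup>2 * (1 - (F x)\<^sup>2)"
proof -
  have x0: "x \<noteq> 0" using x by auto
  have "(\<Sum>b\<in>Basis. (dderiv b F x - real d * F x * (x \<bullet> b))\<^sup>2)
    = (\<Sum>b\<in>Basis. (dderiv b F x)\<^sup>2) - 2 * real d * F x * (\<Sum>b\<in>Basis. (x \<bullet> b) * dderiv b F x)
      + (real d * F x)\<^sup>2 * (\<Sum>b\<in>Basis. (x \<bullet> b)\<^sup>2)"
    by (simp add: power2_diff sum.distrib sum_subtractf sum_distrib_left power_mult_distrib algebra_simps)
  also have "\<dots> = (real d)\<^sup>2 - 2 * real d * F x * (real d * F x) + (real d * F x)\<^sup>2 * 1"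
    using F_grad[OF x] by (simp add: F_euler[OF x0] sum_inner_sq[OF x] grad_sq_def)
  finally show ?thesis by (simp add: power2_eq_square algebra_simps)
qed

lemma F_sq_le_1:
  assumes x: "norm x = 1"
  shows "(F x)\<^sup>2 \<le> 1"
proof -
  have "0 \<le> (real d)\<^sup>2 * (1 - (F x)\<^sup>2)"
    unfolding tangential_grad_sq[OF x, symmetric] by (intro sum_nonneg) simp
  then show ?thesis using d by (simp add: zero_le_mult_iff)
qed

text \<open>The variable y = (1 - f) / 2, extended from the sphere with degree 0.\<close>

definition yc :: "'a \<Rightarrow> real" where
  "yc x = (1 - F x * inverse (norm x) ^ d) / 2"

definition zonal :: "real poly \<Rightarrow> 'a \<Rightarrow> real" where
  "zonal Q x = poly Q (yc x)"

lemma yc_alg: "radial_alg yc"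
proof -
  have "radial_alg (\<lambda>x. 1 / 2 + (- 1 / 2) * (F x * inverse (norm x) ^ d))"
    by (intro radial_alg.add radial_alg.mult radial_alg.const radial_alg_power radial_alg.inv F_alg)
  then show ?thesis by (simp add: yc_def[abs_def] field_simps)
qed

lemma yc_hom: "r > 0 \<Longrightarrow> yc (r *\<^sub>R x) = yc x"
  by (simp add: yc_def F_hom power_mult_distrib power_inverse)

lemma yc_sphere: "norm x = 1 \<Longrightarrow> yc x = (1 - F x) / 2"
  by (simp add: yc_def)

lemma hom0_C2_zonal: "hom0_C2 (zonal Q)"
  unfolding zonal_def
  by (rule radial_alg_hom0_C2) (auto intro: radial_alg_poly yc_alg simp: yc_hom)

text \<open>Chain rule: the Laplacian of Q(y) is Q''(y) |grad y|^2 + Q'(y) times the Laplacian of y.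
  Both are functions of y alone, by the gradient and Laplace equations of F.\<close>

lemma zonal_lap_poly:
  assumes x: "norm x = 1"
  shows "eucl_lap (zonal Q) x
    = (real d)\<^sup>2 * poly ([:0, 1, -1:] * pderiv (pderiv Q) + [:g, - (a + 1):] * pderiv Q) (yc x)"
proof -
  have x0: "x \<noteq> 0" using x by auto
  \<comment> \<open>\<open>e b z\<close> is the partial derivative of \<open>yc\<close> at every
    nonzero z, because it is differentiated once more; \<open>e' b\<close> below is the second
    derivative with norm x = 1 already inserted.\<close>
  define e where "e b z = - (dderiv b F z * inverse (norm z) ^ d
      - real d * F z * inverse (norm z) ^ (d + 2) * (z \<bullet> b)) / 2" for b z
  have yc': "((\<lambda>t. yc (z + t *\<^sub>R b)) has_real_derivative e b z) (at 0)" if "z \<noteq> 0" for b z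
    unfolding yc_def e_def
    using DERIV_cdivide[OF DERIV_diff[OF DERIV_const[of 1]
          DERIV_mult[OF F_dirderiv[OF that, of b] inverse_norm_dirderiv[OF that, of b d]]], of 2]
    by (simp add: algebra_simps)
  have zonal': "((\<lambda>t. zonal Q (z + t *\<^sub>R b)) has_real_derivative zonal (pderiv Q) z * e b z) (at 0)"
    if "z \<noteq> 0" for b z Q
    unfolding zonal_def
    using DERIV_chain2[OF _ yc'[OF that, of b], of "poly Q" "poly (pderiv Q) (yc z)"] poly_DERIV[of Q] by simp
  define e' where "e' b = - (dderiv b (dderiv b F) x - 2 * real d * ((x \<bullet> b) * dderiv b F x)
      - real d * F x + real d * (real d + 2) * F x * (x \<bullet> b)\<^sup>2) / 2" for b
  have e': "((\<lambda>t. e b (x + t *\<^sub>R b)) has_real_derivative e' b) (at 0)" if "b \<in> Basis" for b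
  proof -
    have inner: "((\<lambda>t. (x + t *\<^sub>R b) \<bullet> b) has_real_derivative 1) (at 0)"
      using that by (auto intro!: derivative_eq_intros simp: inner_add_left)
    have nx: "inverse (norm x) = 1" using x by simp
    have pow: "((\<lambda>t. inverse (norm (x + t *\<^sub>R b)) ^ k) has_real_derivative - (real k * (x \<bullet> b))) (at 0)" for k
      using inverse_norm_dirderiv[OF x0, of b k] unfolding nx by simp
    have "((\<lambda>t. dderiv b F (x + t *\<^sub>R b) * inverse (norm (x + t *\<^sub>R b)) ^ d) has_real_derivative
        dderiv b (dderiv b F) x + - (real d * (x \<bullet> b)) * dderiv b F x) (at 0)"
      using DERIV_mult[OF F_dirderiv2[OF x0, of b] pow[of d]] by (simp add: nx)
    moreover
    have "((\<lambda>t. F (x + t *\<^sub>R b) * inverse (norm (x + t *\<^sub>R b)) ^ (d + 2)) has_real_derivative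
        dderiv b F x + - (real (d + 2) * (x \<bullet> b)) * F x) (at 0)"
      using DERIV_mult[OF F_dirderiv[OF x0, of b] pow[of "d + 2"]] by (simp add: nx)
    from DERIV_cmult[OF DERIV_mult[OF this inner], of "real d"]
    have "((\<lambda>t. real d * (F (x + t *\<^sub>R b) * inverse (norm (x + t *\<^sub>R b)) ^ (d + 2) * ((x + t *\<^sub>R b) \<bullet> b)))
        has_real_derivative real d * ((dderiv b F x + - (real (d + 2) * (x \<bullet> b)) * F x) * (x \<bullet> b) + F x)) (at 0)"
      by (simp add: nx)
    ultimately have "((\<lambda>t. - (dderiv b F (x + t *\<^sub>R b) * inverse (norm (x + t *\<^sub>R b)) ^ d
        - real d * (F (x + t *\<^sub>R b) * inverse (norm (x + t *\<^sub>R b)) ^ (d + 2) * ((x + t *\<^sub>R b) \<bullet> b))) / 2)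
        has_real_derivative - ((dderiv b (dderiv b F) x + - (real d * (x \<bullet> b)) * dderiv b F x)
          - real d * ((dderiv b F x + - (real (d + 2) * (x \<bullet> b)) * F x) * (x \<bullet> b) + F x)) / 2) (at 0)"
      by (intro DERIV_cdivide DERIV_minus DERIV_diff)
    moreover have "- ((dderiv b (dderiv b F) x + - (real d * (x \<bullet> b)) * dderiv b F x)
          - real d * ((dderiv b F x + - (real (d + 2) * (x \<bullet> b)) * F x) * (x \<bullet> b) + F x)) / 2 = e' b"
      by (simp add: e'_def power2_eq_square algebra_simps)
    ultimately show ?thesis by (simp only: e_def mult.assoc)
  qed
  have "dderiv b (dderiv b (zonal Q)) x = zonal (pderiv (pderiv Q)) x * (e b x)\<^sup>2 + zonal (pderiv Q) x * e' b"
    if b: "b \<in> Basis" for b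
  proof -
    have "dderiv b (dderiv b (zonal Q)) x = dderiv b (\<lambda>z. zonal (pderiv Q) z * e b z) x"
      by (rule dderiv_cong) (use dderiv_eqI[OF zonal'] x0 in auto)
    also have "\<dots> = zonal (pderiv (pderiv Q)) x * e b x * e b x + e' b * zonal (pderiv Q) x"
      using DERIV_mult[OF zonal'[OF x0, of "pderiv Q" b] e'[OF b]] by (intro dderiv_eqI) simp
    finally show ?thesis by (simp add: power2_eq_square)
  qed
  then have "eucl_lap (zonal Q) x
      = zonal (pderiv (pderiv Q)) x * (\<Sum>b\<in>Basis. (e b x)\<^sup>2) + zonal (pderiv Q) x * (\<Sum>b\<in>Basis. e' b)"
    by (simp add: eucl_lap_def sum.distrib sum_distrib_left)
  also have "(\<Sum>b\<in>Basis. (e b x)\<^sup>2) = (real d)\<^sup>2 * (yc x * (1 - yc x))"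
  proof -
    have "(\<Sum>b\<in>Basis. (e b x)\<^sup>2) = (\<Sum>b\<in>Basis. (dderiv b F x - real d * F x * (x \<bullet> b))\<^sup>2 / 4)"
      by (simp add: e_def x power_divide power2_commute)
    also have "\<dots> = (real d)\<^sup>2 * (1 - (F x)\<^sup>2) / 4"
      by (simp add: sum_divide_distrib[symmetric] tangential_grad_sq[OF x])
    finally show ?thesis by (simp add: yc_sphere[OF x] power2_eq_square field_simps)
  qed
  \<comment> \<open>The Laplacian of y. The constant c enters here, through \<open>F_lap\<close>,
    and ends up in g.\<close>
  also have "(\<Sum>b\<in>Basis. e' b) = (real d)\<^sup>2 * (g - (a + 1) * yc x)"
  proof -
    have "(\<Sum>b\<in>Basis. e' b) = - ((\<Sum>b\<in>Basis. dderiv b (dderiv b F) x)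
        - 2 * real d * (\<Sum>b\<in>Basis. (x \<bullet> b) * dderiv b F x) - real d * F x * real DIM('a)
        + real d * (real d + 2) * F x * (\<Sum>b\<in>Basis. (x \<bullet> b)\<^sup>2)) / 2"
      by (simp add: e'_def sum_divide_distrib[symmetric] sum_negf sum.distrib sum_subtractf sum_distrib_left)
    also have "\<dots> = - (c / 2 * (real d)\<^sup>2 - 2 * real d * (real d * F x) - real d * F x * real DIM('a)
        + real d * (real d + 2) * F x) / 2"
      using F_lap[OF x] by (simp add: F_euler[OF x0] sum_inner_sq[OF x] eucl_lap_def)
    also have "\<dots> = (real d)\<^sup>2 * (g - (a + 1) * yc x)"
      using d by (simp add: g_def a_def yc_sphere[OF x] field_simps power2_eq_square)
    finally show ?thesis .
  qed
  finally have lap: "eucl_lap (zonal Q) x = zonal (pderiv (pderiv Q)) x * ((real d)\<^sup>2 * (yc x * (1 - yc x)))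
      + zonal (pderiv Q) x * ((real d)\<^sup>2 * (g - (a + 1) * yc x))" .
  show ?thesis unfolding lap by (simp add: zonal_def algebra_simps)
qed

lemma a_pos: "a > 0"
  using d dim by (simp add: a_def)

lemma g_pos: "g > 0"
  using a_pos c by (simp add: g_def)

text \<open>This is d^2 m (m + a); in ambient dimension n + 1 it reads d m (n + d m - 1).\<close>

definition ev :: "nat \<Rightarrow> real" where
  "ev m = real (d * m) * (real DIM('a) + real (d * m) - 2)"

lemma zonal_lap:
  assumes x: "norm x = 1"
  shows "eucl_lap (zonal (jacobi m a g)) x
    = - ev m * zonal (jacobi m a g) x"
  unfolding zonal_lap_poly[OF x] jacobi_ode[OF g_pos]
  using d by (simp add: ev_def zonal_def a_def power2_eq_square field_simps)

end

section \<open>Invariant eigenfunctions\<close>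

lemma annular_avg_LIMSEQ:
  fixes h :: "nat \<Rightarrow> 'a::euclidean_space \<Rightarrow> real"
  assumes cont: "\<And>k. continuous_on (- {0}) (h k)" "continuous_on (- {0}) f" "continuous_on (- {0}) w"
    and lim: "\<And>x. x \<noteq> 0 \<Longrightarrow> (\<lambda>k. h k x) \<longlonglongrightarrow> f x"
    and bound: "\<And>k x. x \<noteq> 0 \<Longrightarrow> \<bar>h k x\<bar> \<le> w x"
  shows "(\<lambda>k. annular_avg (h k)) \<longlonglongrightarrow> annular_avg f"
  unfolding annular_avg_def
proof (rule integral_dominated_convergence)
  show "(\<lambda>x. cutoff x / (x \<bullet> x) * f x) \<in> borel_measurable lborel"
    "\<And>k. (\<lambda>x. cutoff x / (x \<bullet> x) * h k x) \<in> borel_measurable lborel"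
    by (intro borel_measurable_integrable annular_avg_integrable cont)+
  show "integrable lborel (\<lambda>x. cutoff x / (x \<bullet> x) * w x)"
    by (intro annular_avg_integrable cont)
  show "AE x in lborel. (\<lambda>k. cutoff x / (x \<bullet> x) * h k x) \<longlonglongrightarrow> cutoff x / (x \<bullet> x) * f x"
  proof (rule AE_I2)
    show "(\<lambda>k. cutoff x / (x \<bullet> x) * h k x) \<longlonglongrightarrow> cutoff x / (x \<bullet> x) * f x" for x
    proof (cases "x = 0")
      case False
      then show ?thesis by (intro tendsto_mult_left lim)
    qed simp
  qed
  show "AE x in lborel. norm (cutoff x / (x \<bullet> x) * h k x) \<le> cutoff x / (x \<bullet> x) * w x" for k
  proof (rule AE_I2)
    show "norm (cutoff x / (x \<bullet> x) * h k x) \<le> cutoff x / (x \<bullet> x) * w x" for x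
    proof (cases "x = 0")
      case False
      have nn: "cutoff x / (x \<bullet> x) \<ge> 0" by (simp add: cutoff_nonneg)
      have "norm (cutoff x / (x \<bullet> x) * h k x) = cutoff x / (x \<bullet> x) * \<bar>h k x\<bar>"
        by (simp only: real_norm_def abs_mult abs_of_nonneg[OF nn])
      then show ?thesis
        using mult_left_mono[OF bound[OF False, of k] nn] by (rule ord_eq_le_trans)
    qed simp
  qed
qed

text \<open>A continuous map from a compact set to a Hausdorff space is closed, hence a quotient map
  onto its image. Invariance provides \<phi> only as a function; this makes it continuous.\<close>

lemma continuous_on_factor:
  fixes f :: "'a::topological_space \<Rightarrow> 'b::t2_space" and w :: "'a \<Rightarrow> 'c::topological_space"
  assumes S: "compact S" and f: "continuous_on S f" and w: "continuous_on S w"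
    and eq: "\<And>x. x \<in> S \<Longrightarrow> w x = \<phi> (f x)"
  shows "continuous_on (f ` S) \<phi>"
  unfolding continuous_on_closed_invariant
proof (intro allI impI)
  fix B :: "'c set" assume "closed B"
  then obtain C where C: "closed C" "C \<inter> S = w -` B \<inter> S"
    using w unfolding continuous_on_closed_invariant by blast
  have "compact (S \<inter> C)" using S C(1) by (rule compact_Int_closed)
  then have "compact (f ` (S \<inter> C))"
    by (intro compact_continuous_image continuous_on_subset[OF f]) auto
  moreover have "f ` (S \<inter> C) \<inter> f ` S = \<phi> -` B \<inter> f ` S"
  proof -
    have "x \<in> C \<longleftrightarrow> \<phi> (f x) \<in> B" if "x \<in> S" for x
    proof -
      have "x \<in> C \<inter> S \<longleftrightarrow> x \<in> w -` B \<inter> S" by (simp only: C(2))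
      then show ?thesis by (simp add: eq[OF that] that)
    qed
    then show ?thesis by auto
  qed
  ultimately show "\<exists>A. closed A \<and> A \<inter> f ` S = \<phi> -` B \<inter> f ` S"
    using compact_imp_closed by blast
qed

lemma Weierstrass_poly:
  fixes \<phi> :: "real \<Rightarrow> real"
  assumes "compact K" "continuous_on K \<phi>" "e > 0"
  obtains p :: "real poly" where "\<And>t. t \<in> K \<Longrightarrow> \<bar>\<phi> t - poly p t\<bar> < e"
proof -
  obtain h where h: "real_polynomial_function h" "\<And>t. t \<in> K \<Longrightarrow> \<bar>\<phi> t - h t\<bar> < e"
    using Stone_Weierstrass_real_polynomial_function[OF assms] by blast
  obtain a n where an: "h = (\<lambda>x. \<Sum>i\<le>n. a i * x ^ i)"
    using real_polynomial_function_imp_sum[OF h(1)] by blast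
  have "poly (\<Sum>i\<le>n. monom (a i) i) t = h t" for t
    by (simp add: an poly_sum poly_monom)
  then show ?thesis using h(2) that by metis
qed

lemma sphere_normalize: "(x::'a::real_normed_vector) \<noteq> 0 \<Longrightarrow> norm (x /\<^sub>R norm x) = 1"
  by simp

section \<open>Orthogonality and completeness of the zonal Jacobi polynomials\<close>

context muenzner
begin

abbreviation J :: "nat \<Rightarrow> real poly" where "J m \<equiv> jacobi m a g"

definition L :: "real poly \<Rightarrow> real" where "L Q = annular_avg (zonal Q)"

lemma zonal_cont: "continuous_on (- {0}) (zonal Q)"
  by (rule hom0_C2_cont[OF hom0_C2_zonal])

lemma zonal_normalize: "x \<noteq> 0 \<Longrightarrow> zonal Q (x /\<^sub>R norm x) = zonal Q x"
  by (rule hom0_C2_scale[OF hom0_C2_zonal]) simp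

lemma zonal_mult: "zonal (p * q) x = zonal p x * zonal q x"
  by (simp add: zonal_def)

lemma L_add: "L (p + q) = L p + L q"
  using annular_avg_add[OF zonal_cont zonal_cont, of p q] by (simp add: L_def zonal_def[abs_def])

lemma L_smult: "L (smult r p) = r * L p"
  using annular_avg_cmult[of r "zonal p"] by (simp add: L_def zonal_def[abs_def])

text \<open>Green's identity moves the Laplacian from h to the eigenfunction \<open>J m\<close>. The
  right-hand side G is arbitrary, so that the lemma serves both eigenfunctions and the nonlinear
  equation.\<close>

lemma zonal_pairing:
  assumes h: "hom0_C2 h" and lap: "\<And>x. norm x = 1 \<Longrightarrow> eucl_lap h x = G x"
  shows "annular_avg (\<lambda>x. zonal (J m) x * (G (x /\<^sub>R norm x) + ev m * h x)) = 0"
proof -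
  have "annular_avg (\<lambda>x. zonal (J m) x * (G (x /\<^sub>R norm x) + ev m * h x))
    = annular_avg (\<lambda>x. zonal (J m) x * eucl_lap h (x /\<^sub>R norm x) - h x * eucl_lap (zonal (J m)) (x /\<^sub>R norm x))"
  proof (rule annular_avg_cong)
    fix x :: 'a assume x: "x \<noteq> 0"
    show "zonal (J m) x * (G (x /\<^sub>R norm x) + ev m * h x)
      = zonal (J m) x * eucl_lap h (x /\<^sub>R norm x) - h x * eucl_lap (zonal (J m)) (x /\<^sub>R norm x)"
      unfolding zonal_lap[OF sphere_normalize[OF x]] zonal_normalize[OF x] lap[OF sphere_normalize[OF x]]
      by (simp add: algebra_simps)
  qed
  also have "\<dots> = 0" by (rule green_annular[OF hom0_C2_zonal h])
  finally show ?thesis .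
qed

lemma eigenfunction_orthogonal:
  assumes h: "hom0_C2 h" and eig: "\<And>x. norm x = 1 \<Longrightarrow> eucl_lap h x = - \<mu> * h x" and "\<mu> \<noteq> ev m"
  shows "annular_avg (\<lambda>x. h x * zonal (J m) x) = 0"
proof -
  have "annular_avg (\<lambda>x. zonal (J m) x * (- \<mu> * h (x /\<^sub>R norm x) + ev m * h x)) = 0"
    using zonal_pairing[OF h eig] by simp
  also have "annular_avg (\<lambda>x. zonal (J m) x * (- \<mu> * h (x /\<^sub>R norm x) + ev m * h x))
      = annular_avg (\<lambda>x. (ev m - \<mu>) * (h x * zonal (J m) x))"
  proof (rule annular_avg_cong)
    fix x :: 'a assume "x \<noteq> 0"
    then have "h (x /\<^sub>R norm x) = h x"
      by (intro hom0_C2_scale[OF h]) simp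
    then show "zonal (J m) x * (- \<mu> * h (x /\<^sub>R norm x) + ev m * h x) = (ev m - \<mu>) * (h x * zonal (J m) x)"
      by (simp add: algebra_simps)
  qed
  finally show ?thesis using \<open>\<mu> \<noteq> ev m\<close> by (simp add: annular_avg_cmult)
qed

lemma ev_strict_mono:
  assumes "n < m"
  shows "ev n < ev m"
proof -
  have "real (d * n) < real (d * m)" using assms d by simp
  moreover have "real (d * n) \<ge> 0" "real DIM('a) \<ge> 3" using dim by simp_all
  ultimately show ?thesis unfolding ev_def by (intro mult_strict_mono') linarith+
qed

lemma ev_inj: "ev n = ev m \<Longrightarrow> n = m"
  using ev_strict_mono[of n m] ev_strict_mono[of m n] by (cases n m rule: linorder_cases) auto

lemma J_orth:
  assumes "n \<noteq> m"
  shows "L (J n * J m) = 0"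
proof -
  have "annular_avg (\<lambda>x. zonal (J n) x * zonal (J m) x) = 0"
    by (rule eigenfunction_orthogonal[OF hom0_C2_zonal zonal_lap]) (use assms ev_inj in auto)
  then show ?thesis by (simp add: L_def zonal_mult[abs_def])
qed

sublocale jacobi_functional L a g
  by unfold_locales (use L_add L_smult a_pos g_pos J_orth in auto)

lemma L_one_pos: "L 1 > 0"
proof -
  have "annular_avg (\<lambda>x::'a. 0) \<le> annular_avg (\<lambda>x::'a. 1)"
    by (rule annular_avg_mono) auto
  moreover have "annular_avg (\<lambda>x::'a. 1) \<noteq> 0"
  proof
    assume "annular_avg (\<lambda>x::'a. 1) = 0"
    moreover obtain b :: 'a where "b \<in> Basis" using nonempty_Basis by blast
    ultimately show False
      using annular_avg_eq_0D[of "\<lambda>x::'a. 1" b] by (auto simp: nonzero_Basis)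
  qed
  ultimately show ?thesis by (simp add: L_def zonal_def[abs_def] annular_avg_def)
qed

lemma L_square_nonneg: "L (Q * Q) \<ge> 0"
proof -
  have "annular_avg (\<lambda>x::'a. 0) \<le> annular_avg (zonal (Q * Q))"
    by (rule annular_avg_mono[OF continuous_on_const zonal_cont]) (simp add: zonal_mult)
  then show ?thesis by (simp add: L_def annular_avg_def)
qed

lemma L_square_eq_0D:
  assumes "L (Q * Q) = 0" "x \<noteq> 0"
  shows "zonal Q x = 0"
proof -
  have "zonal (Q * Q) x = 0"
    by (rule annular_avg_eq_0D[OF zonal_cont])
      (use assms hom0_C2_scale[OF hom0_C2_zonal] in \<open>auto simp: L_def zonal_mult\<close>)
  then show ?thesis by (simp add: zonal_mult)
qed

text \<open>Strictness of \<open>\<beta> > -1\<close>: otherwise \<open>F\<close> is the constant \<open>-1\<close> on the sphere and carries no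
  nonconstant eigenfunction.\<close>

lemma g_less:
  assumes pos: "L (J i * J i) > 0" and i: "i > 0"
  shows "g < a + 1"
proof -
  have J1: "J 1 = [:1, - ((a + 1) / g):]"
  proof (rule poly_eqI)
    show "coeff (J 1) k = coeff [:1, - ((a + 1) / g):] k" for k
    proof (cases "k \<le> 1")
      case True
      then have "k = 0 \<or> k = 1" by auto
      then show ?thesis by (auto simp: jacobi_coeff_def minus_divide_left)
    next
      case False
      then obtain l where "k = Suc (Suc l)"
        using not_less_eq_eq not0_implies_Suc by (metis One_nat_def Suc_le_D nat_le_linear not_less_eq_eq)
      then show ?thesis using False jacobi_coeff_eq_0[of 1 k a g] by simp
    qed
  qed
  \<comment> \<open>Expanding 1 - y in J_1 and J_0 shows that its mean is (\<beta> + 1) / (a + 1).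
    Since F \<ge> -1 on the sphere, 1 - y is nonnegative, so this mean is positive unless y = 1
    everywhere.\<close>
  have "[:1, -1:] = smult (g / (a + 1)) (J 1 * J 0) + smult ((a + 1 - g) / (a + 1)) 1"
  proof -
    have "a + 1 \<noteq> 0" "g \<noteq> 0" using a_pos g_pos by simp_all
    then have "g / (a + 1) + (a + 1 - g) / (a + 1) = 1" "g / (a + 1) * - ((a + 1) / g) = - 1"
      by (simp_all add: add_divide_distrib[symmetric])
    then show ?thesis unfolding J1 jacobi_0 mult_1_right by (simp add: one_pCons)
  qed
  then have eq: "L [:1, -1:] = (a + 1 - g) / (a + 1) * L 1"
    by (simp only: L_add L_smult J_orth[of 1 0])
  have yc_le: "yc x \<le> 1" if "x \<noteq> 0" for x
  proof -
    have "(F (x /\<^sub>R norm x))\<^sup>2 \<le> 1" using F_sq_le_1[OF sphere_normalize[OF that]] .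
    then have "\<bar>F (x /\<^sub>R norm x)\<bar> \<le> 1"
      by (simp only: abs_square_le_1)
    then have "- 1 \<le> F (x /\<^sub>R norm x)" by linarith
    moreover have "yc x = (1 - F (x /\<^sub>R norm x)) / 2"
      using yc_sphere[OF sphere_normalize[OF that]] yc_hom[of "inverse (norm x)" x] that by simp
    ultimately show ?thesis by simp
  qed
  have z: "zonal [:1, -1:] x = 1 - yc x" for x by (simp add: zonal_def)
  have "annular_avg (\<lambda>x::'a. 0) \<le> annular_avg (zonal [:1, -1:])"
    by (rule annular_avg_mono[OF continuous_on_const zonal_cont]) (simp add: z yc_le)
  then have "L [:1, -1:] \<ge> 0" by (simp add: L_def annular_avg_def)
  moreover have "L [:1, -1:] \<noteq> 0"
  proof
    assume L0: "L [:1, -1:] = 0"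
    have yc1: "yc x = 1" if "x \<noteq> 0" for x
    proof -
      have "zonal [:1, -1:] x = 0"
        by (rule annular_avg_eq_0D[OF zonal_cont])
          (use L0 that yc_le hom0_C2_scale[OF hom0_C2_zonal] in \<open>auto simp: L_def z yc_hom\<close>)
      then show ?thesis by (simp add: z)
    qed
    \<comment> \<open>If y = 1 everywhere, then \<open>L\<close> is evaluation at 1 up to a factor.
      Orthogonality to J_0 gives J_i(1) = 0, against the positivity of
      \<open>L (J i * J i)\<close>.\<close>
    have const: "L Q = poly Q 1 * L 1" for Q
    proof -
      have "annular_avg (zonal Q) = annular_avg (\<lambda>x. poly Q 1 * zonal 1 x)"
        by (rule annular_avg_cong) (simp add: zonal_def yc1)
      then show ?thesis by (simp add: annular_avg_cmult L_def)
    qed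
    have "L (J i) = 0" using J_orth[of i 0] i by simp
    then have "poly (J i) 1 = 0" using const[of "J i"] L_one_pos by simp
    then show False using const[of "J i * J i"] pos by simp
  qed
  ultimately have "(a + 1 - g) / (a + 1) * L 1 > 0" using eq by linarith
  then show ?thesis using L_one_pos a_pos by (simp add: zero_less_mult_iff zero_less_divide_iff)
qed

lemma L_cube_eq_0_iff:
  assumes pos: "L (J i * J i) > 0" and i: "i > 0"
  shows "L (J i * J i * J i) = 0 \<longleftrightarrow> c = 0 \<and> odd i"
proof (cases "c = 0")
  case True
  then have "2 * g = a + 1" by (simp add: g_def)
  then show ?thesis
    using gegenbauer_cube_odd[of i] gegenbauer_cube_even[of i] pos i True by (cases "odd i") auto
next
  case False
  then have "c < 0" using c by simp
  then have "2 * g > a + 1" by (simp add: g_def field_simps)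
  then show ?thesis using jacobi_cube_pos[OF pos i g_less[OF pos i]] False by simp
qed

text \<open>\<open>J k\<close> has exact degree k, as none of the three Pochhammer factors of its
  top coefficient vanishes. The system expressing the \<open>J k\<close> in monomials is triangular
  and can be solved degree by degree.\<close>

lemma monomials_from_J:
  assumes w: "continuous_on (- {0}) w" and orth: "\<And>m. annular_avg (\<lambda>x. w x * zonal (J m) x) = 0"
  shows "annular_avg (\<lambda>x. w x * zonal Q x) = 0"
proof -
  define \<Lambda> where "\<Lambda> Q = annular_avg (\<lambda>x. w x * zonal Q x)" for Q
  have add: "\<Lambda> (p + q) = \<Lambda> p + \<Lambda> q" for p q
    using annular_avg_add[of "\<lambda>x. w x * zonal p x" "\<lambda>x. w x * zonal q x"] w zonal_cont
    by (simp add: \<Lambda>_def zonal_def[abs_def] distrib_left continuous_on_mult)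
  have smult: "\<Lambda> (smult r p) = r * \<Lambda> p" for r p
    using annular_avg_cmult[of r "\<lambda>x. w x * zonal p x"] by (simp add: \<Lambda>_def zonal_def mult.left_commute)
  have sum: "\<Lambda> (\<Sum>k\<in>I. p k) = (\<Sum>k\<in>I. \<Lambda> (p k))" for I and p :: "nat \<Rightarrow> real poly"
    using smult[of 0 0] by (induction I rule: infinite_finite_induct) (simp_all add: add)
  have mono: "\<Lambda> (monom r k) = r * \<Lambda> (monom 1 k)" for r k
    using smult[of r "monom 1 k"] by (simp add: smult_monom)
  have "\<Lambda> (monom 1 k) = 0" for k
  proof (induction k rule: less_induct)
    case (less k)
    have "0 = \<Lambda> (J k)" using orth[of k] by (simp add: \<Lambda>_def)
    also have "\<dots> = (\<Sum>j\<le>k. jacobi_coeff k a g j * \<Lambda> (monom 1 j))"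
      unfolding jacobi_def sum by (intro sum.cong refl mono)
    also have "\<dots> = jacobi_coeff k a g k * \<Lambda> (monom 1 k)"
      using less by (simp add: lessThan_Suc_atMost[symmetric])
    finally have "jacobi_coeff k a g k * \<Lambda> (monom 1 k) = 0" ..
    moreover have "jacobi_coeff k a g k \<noteq> 0"
    proof -
      have "pochhammer (- real k) k \<noteq> 0"
        by (simp add: pochhammer_same)
      moreover have "pochhammer (real k + a) k > 0"
        using a_pos by (intro pochhammer_pos) simp
      moreover have "pochhammer g k > 0"
        using g_pos by (rule pochhammer_pos)
      ultimately show ?thesis by (simp add: jacobi_coeff_def)
    qed
    ultimately show ?case by simp
  qed
  then have "\<Lambda> (\<Sum>j\<le>degree Q. monom (coeff Q j) j) = 0"
    unfolding sum by (simp add: mono[of "coeff Q _"])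
  then show ?thesis by (simp add: poly_as_sum_of_monoms \<Lambda>_def)
qed

text \<open>Weierstrass approximation of \<open>\<phi>\<close> replaces a regularity theory for the radial ODE at
  the focal sets.\<close>

lemma invariant_orthogonal_eq_0:
  assumes w: "continuous_on (- {0}) w" and hom: "\<And>r x. r > 0 \<Longrightarrow> w (r *\<^sub>R x) = w x"
    and inv: "\<And>x. norm x = 1 \<Longrightarrow> w x = \<phi> (F x)"
    and orth: "\<And>m. annular_avg (\<lambda>x. w x * zonal (J m) x) = 0" and "x \<noteq> 0"
  shows "w x = 0"
proof -
  define I where "I = annular_avg (\<lambda>x. \<bar>w x\<bar>)"
  have F: "continuous_on (sphere 0 1) F"
    by (rule continuous_on_subset[OF radial_alg_continuous_on[OF F_alg]]) auto
  have "continuous_on (F ` sphere 0 1) \<phi>"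
    by (rule continuous_on_factor[OF compact_sphere F continuous_on_subset[OF w]]) (auto simp: inv)
  moreover have "compact (F ` sphere 0 1)"
    by (intro compact_continuous_image F compact_sphere)
  ultimately have approx: "\<exists>p. \<forall>t\<in>F ` sphere 0 1. \<bar>\<phi> t - poly p t\<bar> < e" if "e > 0" for e
    using Weierstrass_poly[OF _ _ that] by metis
  have le: "annular_avg (\<lambda>x. w x * w x) \<le> e * I" if e: "e > 0" for e
  proof -
    obtain p where p: "\<And>t. t \<in> F ` sphere 0 1 \<Longrightarrow> \<bar>\<phi> t - poly p t\<bar> < e"
      using approx[OF e] by blast
    \<comment> \<open>The substitution t = 1 - 2 y undoes y = (1 - F) / 2.\<close>
    define Q where "Q = pcompose p [:1, - 2:]"
    have close: "\<bar>w x - zonal Q x\<bar> \<le> e" if "x \<noteq> 0" for x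
    proof -
      let ?y = "x /\<^sub>R norm x"
      have y: "norm ?y = 1" by (rule sphere_normalize[OF that])
      have "zonal Q x = zonal Q ?y" by (rule zonal_normalize[OF that, symmetric])
      also have "\<dots> = poly p (F ?y)"
        by (simp only: zonal_def yc_sphere[OF y] Q_def poly_pcompose) (simp add: diff_divide_distrib)
      moreover have "w x = \<phi> (F ?y)"
        using hom[of "inverse (norm x)" x] inv[OF y] that by simp
      moreover have "F ?y \<in> F ` sphere 0 1" using y by (intro imageI) simp
      ultimately show ?thesis using p[of "F ?y"] by simp
    qed
    have "annular_avg (\<lambda>x. w x * w x) = annular_avg (\<lambda>x. w x * (w x - zonal Q x) + w x * zonal Q x)"
      by (rule annular_avg_cong) (simp add: algebra_simps)
    also have "\<dots> = annular_avg (\<lambda>x. w x * (w x - zonal Q x)) + annular_avg (\<lambda>x. w x * zonal Q x)"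
      by (intro annular_avg_add continuous_intros w zonal_cont)
    also have "annular_avg (\<lambda>x. w x * zonal Q x) = 0"
      by (rule monomials_from_J[OF w orth])
    also have "annular_avg (\<lambda>x. w x * (w x - zonal Q x)) + 0 \<le> annular_avg (\<lambda>x. e * \<bar>w x\<bar>)"
      unfolding add_0_right
    proof (rule annular_avg_mono)
      show "w x * (w x - zonal Q x) \<le> e * \<bar>w x\<bar>" if "x \<noteq> 0" for x
      proof -
        have "w x * (w x - zonal Q x) \<le> \<bar>w x\<bar> * \<bar>w x - zonal Q x\<bar>"
          by (metis abs_ge_self abs_mult)
        also have "\<dots> \<le> \<bar>w x\<bar> * e" by (intro mult_left_mono close that) simp
        finally show ?thesis by (simp add: mult.commute)
      qed
    qed (intro continuous_intros w zonal_cont)+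
    finally show ?thesis by (simp add: annular_avg_cmult I_def)
  qed
  have "annular_avg (\<lambda>x. w x * w x) \<le> 0"
  proof (rule field_le_epsilon)
    fix e :: real assume e: "e > 0"
    have I: "I \<ge> 0"
      using annular_avg_mono[of "\<lambda>x. 0" "\<lambda>x. \<bar>w x\<bar>"] w
      by (simp add: I_def continuous_on_rabs) (simp add: annular_avg_def)
    have "annular_avg (\<lambda>x. w x * w x) \<le> e / (I + 1) * I"
      using e I by (intro le) simp
    also have "\<dots> \<le> 0 + e" using e I by (simp add: field_simps)
    finally show "annular_avg (\<lambda>x. w x * w x) \<le> 0 + e" .
  qed
  moreover have "annular_avg (\<lambda>x::'a. 0) \<le> annular_avg (\<lambda>x. w x * w x)"
    by (rule annular_avg_mono) (auto intro: continuous_on_mult w)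
  ultimately have "annular_avg (\<lambda>x. w x * w x) = 0"
    by (simp add: annular_avg_def)
  then have "w x * w x = 0"
    by (intro annular_avg_eq_0D[of "\<lambda>x. w x * w x"]) (use \<open>x \<noteq> 0\<close> hom in \<open>auto intro: continuous_on_mult w\<close>)
  then show ?thesis by simp
qed

text \<open>Subtracting the component along \<open>J i\<close> leaves an invariant function
  orthogonal to every \<open>J m\<close>: by distinct eigenvalues for m \<noteq> i, by the choice of
  b for m = i. Completeness makes it zero. As v is nonzero at z, so is \<open>zonal (J i)\<close>,
  whence the positive square.\<close>

lemma invariant_eigenfunction:
  assumes v: "hom0_C2 v" and inv: "\<And>x. norm x = 1 \<Longrightarrow> v x = \<phi> (F x)"
    and eig: "\<And>x. norm x = 1 \<Longrightarrow> eucl_lap v x = - ev i * v x"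
    and nz: "norm z = 1" "v z \<noteq> 0"
  obtains b where "b \<noteq> 0" "\<And>x. x \<noteq> 0 \<Longrightarrow> v x = b * zonal (J i) x" "L (J i * J i) > 0"
proof -
  \<comment> \<open>If the denominator is 0, division by zero gives b = 0; this is consistent,
    because \<open>zonal (J i)\<close> then vanishes off the origin.\<close>
  define b where "b = annular_avg (\<lambda>x. v x * zonal (J i) x) / L (J i * J i)"
  define w where "w x = v x - b * zonal (J i) x" for x
  have w: "continuous_on (- {0}) w"
    unfolding w_def by (intro continuous_intros hom0_C2_cont[OF v] zonal_cont)
  have orth: "annular_avg (\<lambda>x. w x * zonal (J m) x) = 0" for m
  proof -
    have "annular_avg (\<lambda>x. w x * zonal (J m) x)
        = annular_avg (\<lambda>x. v x * zonal (J m) x + (- b) * zonal (J i * J m) x)"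
      by (rule annular_avg_cong) (simp add: w_def zonal_mult algebra_simps)
    also have "\<dots> = annular_avg (\<lambda>x. v x * zonal (J m) x) + annular_avg (\<lambda>x. (- b) * zonal (J i * J m) x)"
      by (intro annular_avg_add continuous_intros hom0_C2_cont[OF v] zonal_cont)
    also have "\<dots> = annular_avg (\<lambda>x. v x * zonal (J m) x) - b * L (J i * J m)"
      by (simp only: annular_avg_cmult L_def)
    also have "\<dots> = 0"
    proof (cases "m = i")
      case False
      have "annular_avg (\<lambda>x. v x * zonal (J m) x) = 0"
        by (rule eigenfunction_orthogonal[OF v eig]) (use False ev_inj in auto)
      then show ?thesis using J_orth[of i m] False by simp
    next
      case True
      show ?thesis
      proof (cases "L (J i * J i) = 0")
        case False
        then show ?thesis using True by (simp add: b_def)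
      next
        case zero: True
        have "annular_avg (\<lambda>x. v x * zonal (J i) x) = annular_avg (\<lambda>x::'a. 0)"
          by (rule annular_avg_cong) (simp add: L_square_eq_0D[OF zero])
        then show ?thesis using True zero by (simp add: annular_avg_def)
      qed
    qed
    finally show ?thesis .
  qed
  have w0: "w x = 0" if "x \<noteq> 0" for x
  proof (rule invariant_orthogonal_eq_0[OF w _ _ orth that])
    show "w (r *\<^sub>R x) = w x" if "r > 0" for r x
      using that by (simp add: w_def hom0_C2_scale[OF v] hom0_C2_scale[OF hom0_C2_zonal])
    show "w x = (\<lambda>t. \<phi> t - b * poly (J i) ((1 - t) / 2)) (F x)" if "norm x = 1" for x
      using that by (simp add: w_def inv zonal_def yc_sphere)
  qed
  then have eq: "v x = b * zonal (J i) x" if "x \<noteq> 0" for x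
    using that by (simp add: w_def)
  moreover have "z \<noteq> 0" using nz(1) by auto
  ultimately have "b \<noteq> 0" "zonal (J i) z \<noteq> 0" using nz(2) by auto
  moreover from this have "L (J i * J i) \<noteq> 0"
    using L_square_eq_0D[of "J i" z] \<open>z \<noteq> 0\<close> by blast
  then have "L (J i * J i) > 0" using L_square_nonneg[of "J i"] by simp
  ultimately show ?thesis using that eq by blast
qed

end

section \<open>The second-order bifurcation condition\<close>

text \<open>The limit is the second-order Taylor coefficient of (1 + z) - (1 + z)^q, whose linear
  part is cancelled by (q - 1) z. After one use of l'Hopital's rule the quotient is half a
  difference quotient at 0.\<close>

lemma powr_remainder_limit:
  fixes q :: real
  shows "((\<lambda>z. ((1 + z) - (1 + z) powr q + (q - 1) * z) / z\<^sup>2) \<longlongrightarrow> - (q * (q - 1) / 2)) (at 0)"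
proof (rule lhopital)
  have near: "\<forall>\<^sub>F z in at (0::real). z > -1"
    by (rule order_tendstoD[OF tendsto_ident_at]) simp
  have cont: "isCont (\<lambda>z::real. (1 + z) - (1 + z) powr q + (q - 1) * z) 0"
    by (intro continuous_intros) auto
  then show "((\<lambda>z::real. (1 + z) - (1 + z) powr q + (q - 1) * z) \<longlongrightarrow> 0) (at 0)"
    by (simp add: isCont_def)
  show "((\<lambda>z::real. z\<^sup>2) \<longlongrightarrow> 0) (at 0)"
    using tendsto_power[OF tendsto_ident_at[of "0::real" UNIV], of 2] by simp
  show "\<forall>\<^sub>F z::real in at 0. z\<^sup>2 \<noteq> 0" "\<forall>\<^sub>F z::real in at 0. 2 * z \<noteq> 0"
    by (auto simp: eventually_at_filter)
  show "\<forall>\<^sub>F z in at 0. ((\<lambda>z. (1 + z) - (1 + z) powr q + (q - 1) * z) has_real_derivative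
      (q - q * (1 + z) powr (q - 1))) (at z)"
    using near by eventually_elim (auto intro!: derivative_eq_intros)
  show "\<forall>\<^sub>F z::real in at 0. ((\<lambda>z. z\<^sup>2) has_real_derivative 2 * z) (at z)"
    by (rule always_eventually) (auto intro!: derivative_eq_intros)
  have "((\<lambda>z. q - q * (1 + z) powr (q - 1)) has_real_derivative - (q * (q - 1))) (at 0)"
    by (auto intro!: derivative_eq_intros)
  then have "((\<lambda>z. (q - q * (1 + z) powr (q - 1)) / z) \<longlongrightarrow> - (q * (q - 1))) (at 0)"
    by (simp add: has_field_derivative_iff)
  then have "((\<lambda>z. (q - q * (1 + z) powr (q - 1)) / z / 2) \<longlongrightarrow> - (q * (q - 1)) / 2) (at 0)"
    by (intro tendsto_divide) auto
  then show "((\<lambda>z. (q - q * (1 + z) powr (q - 1)) / (2 * z)) \<longlongrightarrow> - (q * (q - 1) / 2)) (at 0)"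
    by (simp add: mult.commute)
qed

context muenzner
begin

text \<open>Pairing the equation with \<open>J i\<close> for every \<open>s\<close> and dividing by \<open>s\<^sup>2\<close> yields the second-order
  bifurcation condition without differentiating the equation twice.\<close>

lemma bifurcation_identity:
  fixes U :: "real \<Rightarrow> 'a \<Rightarrow> real" and lam :: "real \<Rightarrow> real"
  assumes i: "i > 0" and e: "\<epsilon> > 0"
    and U: "\<And>s. 0 < s \<Longrightarrow> s < \<epsilon> \<Longrightarrow> hom0_C2 (U s)"
    and sol: "\<And>s x. 0 < s \<Longrightarrow> s < \<epsilon> \<Longrightarrow> norm x = 1 \<Longrightarrow>
                eucl_lap (U s) x = lam s * U s x - lam s * U s x powr q"
    and pos: "\<And>s x. 0 < s \<Longrightarrow> s < \<epsilon> \<Longrightarrow> x \<noteq> 0 \<Longrightarrow> U s x > 0"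
    and U0: "\<And>x. x \<noteq> 0 \<Longrightarrow> U 0 x = 1"
    and lam: "(lam has_real_derivative l) (at 0)" and lam0: "lam 0 * (q - 1) = ev i"
    and V: "\<And>x. x \<noteq> 0 \<Longrightarrow> ((\<lambda>s. U s x) has_real_derivative V x) (at 0)"
    and V_cont: "continuous_on (- {0}) V"
    and K: "\<And>s x. 0 < s \<Longrightarrow> s < \<epsilon> \<Longrightarrow> x \<noteq> 0 \<Longrightarrow> \<bar>U s x - 1\<bar> \<le> K * s"
  shows "annular_avg (\<lambda>x. zonal (J i) x * (l * (q - 1) * V x + lam 0 * (q * (q - 1) / 2) * (V x)\<^sup>2)) = 0"
proof -
  \<comment> \<open>The value at 0 is the limit, so r is continuous there and
    \<open>r (U s x - 1)\<close> is meaningful where U s x = 1.\<close>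
  define r where "r z = (if z = 0 then - (q * (q - 1) / 2)
      else ((1 + z) - (1 + z) powr q + (q - 1) * z) / z\<^sup>2)" for z :: real
  have r: "(r \<longlongrightarrow> r 0) (at 0)"
  proof -
    have "((\<lambda>z. ((1 + z) - (1 + z) powr q + (q - 1) * z) / z\<^sup>2) \<longlongrightarrow> r 0) (at 0)"
      using powr_remainder_limit[of q] by (simp add: r_def)
    moreover have "\<forall>\<^sub>F z in at 0. ((1 + z) - (1 + z) powr q + (q - 1) * z) / z\<^sup>2 = r z"
      by (auto simp: eventually_at_filter r_def)
    ultimately show ?thesis by (rule Lim_transform_eventually)
  qed
  then have r_nhds: "(r \<longlongrightarrow> r 0) (nhds 0)"
    by (simp add: tendsto_nhds_iff)
  have r_eq: "(1 + z) - (1 + z) powr q = r z * z\<^sup>2 - (q - 1) * z" for z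
    by (simp add: r_def)
  \<comment> \<open>The tested quantity divided by s^2. The relation lam 0 (q - 1) = ev i cancels
    the first-order part, leaving difference quotients of lam and U, which converge as s tends to
    0.\<close>
  define B where "B s x = - ((lam s - lam 0) / s) * (q - 1) * ((U s x - 1) / s)
      + lam s * r (U s x - 1) * ((U s x - 1) / s)\<^sup>2" for s x
  have B_eq: "s\<^sup>2 * B s x = lam s * (U s x - U s x powr q) + ev i * (U s x - 1)" if "s > 0" for s x
  proof -
    define z where "z = U s x - 1"
    have H1: "U s x - U s x powr q = r z * z\<^sup>2 - (q - 1) * z"
      using r_eq[of z] by (simp add: z_def)
    have H2: "s\<^sup>2 * B s x = - (lam s - lam 0) * (q - 1) * z + lam s * r z * z\<^sup>2"
      using that by (simp add: B_def z_def[symmetric] power2_eq_square field_simps)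
    show ?thesis
      unfolding H1 H2 lam0[symmetric] z_def[symmetric] by (simp add: algebra_simps)
  qed
  have B_cont: "continuous_on (- {0}) (B s)" and B_avg: "annular_avg (\<lambda>x. zonal (J i) x * B s x) = 0"
    if s: "0 < s" "s < \<epsilon>" for s
  proof -
    have Us: "continuous_on (- {0}) (U s)" by (rule hom0_C2_cont[OF U[OF s]])
    have "continuous_on (- {0}) (\<lambda>x. (lam s * (U s x - U s x powr q) + ev i * (U s x - 1)) / s\<^sup>2)"
      using pos[OF s] s by (intro continuous_intros Us) force+
    then show "continuous_on (- {0}) (B s)"
      by (rule continuous_on_eq) (use B_eq[OF s(1)] s in \<open>simp add: field_simps\<close>)
    have 1: "annular_avg (\<lambda>x. zonal (J i) x * (lam s * U s (x /\<^sub>R norm x) - lam s * U s (x /\<^sub>R norm x) powr q + ev i * U s x)) = 0"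
      by (rule zonal_pairing[OF U[OF s] sol[OF s]])
    have hom: "U s (x /\<^sub>R norm x) = U s x" if "x \<noteq> 0" for x
      using that by (intro hom0_C2_scale[OF U[OF s]]) simp
    have "annular_avg (\<lambda>x. s\<^sup>2 * (zonal (J i) x * B s x))
      = annular_avg (\<lambda>x. zonal (J i) x * (lam s * U s (x /\<^sub>R norm x) - lam s * U s (x /\<^sub>R norm x) powr q + ev i * U s x)
          + (- ev i) * zonal (J i) x)"
    proof (rule annular_avg_cong)
      fix x :: 'a assume x: "x \<noteq> 0"
      have "s\<^sup>2 * (zonal (J i) x * B s x) = zonal (J i) x * (s\<^sup>2 * B s x)" by simp
      then show "s\<^sup>2 * (zonal (J i) x * B s x) = zonal (J i) x * (lam s * U s (x /\<^sub>R norm x)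
          - lam s * U s (x /\<^sub>R norm x) powr q + ev i * U s x) + (- ev i) * zonal (J i) x"
        unfolding B_eq[OF s(1)] hom[OF x] by (simp add: algebra_simps)
    qed
    also have "\<dots> = annular_avg (\<lambda>x. zonal (J i) x * (lam s * U s (x /\<^sub>R norm x)
          - lam s * U s (x /\<^sub>R norm x) powr q + ev i * U s x)) + annular_avg (\<lambda>x. (- ev i) * zonal (J i) x)"
    proof (rule annular_avg_add)
      have "continuous_on (- {0}) (\<lambda>x. zonal (J i) x * (lam s * U s x - lam s * U s x powr q + ev i * U s x))"
        using pos[OF s] by (intro continuous_intros Us zonal_cont) force+
      then show "continuous_on (- {0}) (\<lambda>x. zonal (J i) x * (lam s * U s (x /\<^sub>R norm x)
          - lam s * U s (x /\<^sub>R norm x) powr q + ev i * U s x))"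
        by (rule continuous_on_eq) (simp add: hom)
      show "continuous_on (- {0}) (\<lambda>x. (- ev i) * zonal (J i) x)"
        by (intro continuous_intros zonal_cont)
    qed
    also have "annular_avg (\<lambda>x. (- ev i) * zonal (J i) x) = 0"
      using J_orth[of i 0] i by (simp only: annular_avg_cmult L_def[symmetric]) simp
    finally have "s\<^sup>2 * annular_avg (\<lambda>x. zonal (J i) x * B s x) = 0"
      unfolding 1 by (simp only: annular_avg_cmult add_0_right)
    then show "annular_avg (\<lambda>x. zonal (J i) x * B s x) = 0" using s by simp
  qed

  have K0: "K \<ge> 0"
  proof -
    obtain b :: 'a where "b \<in> Basis" using nonempty_Basis by blast
    then have "\<bar>U (\<epsilon> / 2) b - 1\<bar> \<le> K * (\<epsilon> / 2)"
      using e by (intro K) (auto simp: nonzero_Basis)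
    then have "0 \<le> K * (\<epsilon> / 2)" by linarith
    then show ?thesis using e by (simp add: zero_le_mult_iff)
  qed
  have lim_lam: "((\<lambda>s. (lam s - lam 0) / s) \<longlongrightarrow> l) (at 0)"
    using lam by (simp add: has_field_derivative_iff)
  have lam_cont: "(lam \<longlongrightarrow> lam 0) (at 0)"
    using DERIV_isCont[OF lam] by (simp add: isCont_def)
  define C where "C = (\<bar>l\<bar> + 1) * \<bar>q - 1\<bar> * K + (\<bar>lam 0\<bar> + 1) * (\<bar>r 0\<bar> + 1) * K\<^sup>2"
  have "\<forall>\<^sub>F z in nhds 0. \<bar>r z\<bar> < \<bar>r 0\<bar> + 1"
    by (rule order_tendstoD[OF tendsto_rabs[OF r_nhds]]) simp
  then obtain \<delta> where \<delta>: "\<delta> > 0" "\<And>z. \<bar>z\<bar> < \<delta> \<Longrightarrow> \<bar>r z\<bar> < \<bar>r 0\<bar> + 1"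
    by (auto simp: eventually_nhds_metric dist_real_def)
  have ev1: "\<forall>\<^sub>F s in at 0. \<bar>(lam s - lam 0) / s\<bar> < \<bar>l\<bar> + 1"
    by (rule order_tendstoD[OF tendsto_rabs[OF lim_lam]]) simp
  have ev2: "\<forall>\<^sub>F s in at 0. \<bar>lam s\<bar> < \<bar>lam 0\<bar> + 1"
    by (rule order_tendstoD[OF tendsto_rabs[OF lam_cont]]) simp
  \<comment> \<open>For s < t the bound K s stays below \<delta>, where r is bounded; K + 1 avoids
    dividing by 0.\<close>
  define t where "t = \<delta> / (K + 1)"
  have t: "t > 0" using \<delta>(1) K0 by (simp add: t_def)
  from ev1 ev2 obtain \<eta> where \<eta>: "\<eta> > 0"
    "\<And>s. s \<noteq> 0 \<Longrightarrow> \<bar>s\<bar> < \<eta> \<Longrightarrow> \<bar>(lam s - lam 0) / s\<bar> < \<bar>l\<bar> + 1 \<and> \<bar>lam s\<bar> < \<bar>lam 0\<bar> + 1"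
    using eventually_conj[OF ev1 ev2] by (auto simp: eventually_at dist_real_def)
  \<comment> \<open>Starting at 1/2 rather than 1 makes \<open>s k\<close> strictly smaller than all
    three bounds already for k = 0.\<close>
  define s where "s k = min \<epsilon> (min t \<eta>) * inverse (real (Suc (Suc k)))" for k
  have s: "0 < s k" "s k < \<epsilon>" "s k < t" "s k < \<eta>" for k
  proof -
    have m: "min \<epsilon> (min t \<eta>) > 0" using e t \<eta>(1) by simp
    have "inverse (real (Suc (Suc k))) < 1" by (simp add: inverse_less_1_iff)
    then have "s k < min \<epsilon> (min t \<eta>)"
      unfolding s_def using mult_strict_left_mono[OF _ m] by fastforce
    then show "s k < \<epsilon>" "s k < t" "s k < \<eta>" by auto
    show "0 < s k" using m by (simp add: s_def)
  qed
  have s0: "filterlim s (at 0) sequentially"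
  proof (rule filterlim_atI)
    have "(\<lambda>k. min \<epsilon> (min t \<eta>) * inverse (real (Suc (Suc k)))) \<longlonglongrightarrow> min \<epsilon> (min t \<eta>) * 0"
      by (intro tendsto_mult_left LIMSEQ_Suc[OF LIMSEQ_inverse_real_of_nat])
    then show "s \<longlonglongrightarrow> 0" by (simp add: s_def[abs_def])
    show "\<forall>\<^sub>F k in sequentially. s k \<noteq> 0"
      using s(1) by (intro always_eventually) (metis less_irrefl)
  qed
  have B_bound: "\<bar>B (s k) x\<bar> \<le> C" if x: "x \<noteq> 0" for k x
  proof -
    define z where "z = U (s k) x - 1"
    have z: "\<bar>z\<bar> \<le> K * s k" unfolding z_def by (rule K[OF s(1,2) x])
    have zs: "\<bar>z / s k\<bar> \<le> K" using z s(1)[of k] by (simp add: abs_divide field_simps)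
    have "K * s k \<le> (K + 1) * s k" using s(1)[of k] by simp
    also have "\<dots> < \<delta>" using s(3)[of k] K0 by (simp add: t_def field_simps)
    finally have rz: "\<bar>r z\<bar> \<le> \<bar>r 0\<bar> + 1" using z \<delta>(2)[of z] by force
    have lb: "\<bar>(lam (s k) - lam 0) / s k\<bar> \<le> \<bar>l\<bar> + 1" "\<bar>lam (s k)\<bar> \<le> \<bar>lam 0\<bar> + 1"
      using \<eta>(2)[of "s k"] s(1,4)[of k] by auto
    have "\<bar>B (s k) x\<bar> \<le> \<bar>(lam (s k) - lam 0) / s k\<bar> * \<bar>q - 1\<bar> * \<bar>z / s k\<bar> + \<bar>lam (s k)\<bar> * \<bar>r z\<bar> * \<bar>z / s k\<bar>\<^sup>2"
      unfolding B_def z_def[symmetric]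
      by (rule order_trans[OF abs_triangle_ineq]) (simp add: abs_mult power_divide)
    also have "\<dots> \<le> C"
      unfolding C_def
      by (intro add_mono mult_mono power_mono lb zs rz mult_nonneg_nonneg) (use K0 in auto)
    finally show ?thesis .
  qed
  define f where "f x = - (l * (q - 1) * V x + lam 0 * (q * (q - 1) / 2) * (V x)\<^sup>2)" for x
  have "(\<lambda>k. annular_avg (\<lambda>x. zonal (J i) x * B (s k) x)) \<longlonglongrightarrow> annular_avg (\<lambda>x. zonal (J i) x * f x)"
  proof (rule annular_avg_LIMSEQ)
    show "continuous_on (- {0}) (\<lambda>x. zonal (J i) x * B (s k) x)" for k
      by (intro continuous_on_mult zonal_cont B_cont s)
    show "continuous_on (- {0}) (\<lambda>x. zonal (J i) x * f x)"
      unfolding f_def by (intro continuous_intros zonal_cont V_cont)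
    show "continuous_on (- {0}) (\<lambda>x. \<bar>zonal (J i) x\<bar> * C)"
      by (intro continuous_intros zonal_cont)
    show "\<bar>zonal (J i) x * B (s k) x\<bar> \<le> \<bar>zonal (J i) x\<bar> * C" if "x \<noteq> 0" for k x
      unfolding abs_mult by (intro mult_left_mono B_bound that) simp
    show "(\<lambda>k. zonal (J i) x * B (s k) x) \<longlonglongrightarrow> zonal (J i) x * f x" if x: "x \<noteq> 0" for x
    proof (rule tendsto_mult_left)
      have z: "((\<lambda>s. (U s x - 1) / s) \<longlongrightarrow> V x) (at 0)"
        using V[OF x] U0[OF x] by (simp add: has_field_derivative_iff)
      have "((\<lambda>s. U s x - 1) \<longlongrightarrow> 0) (at 0)"
        using DERIV_isCont[OF V[OF x]] U0[OF x] by (simp add: isCont_def LIM_zero_iff)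
      then have "((\<lambda>s. r (U s x - 1)) \<longlongrightarrow> r 0) (at 0)"
        by (rule filterlim_compose[OF r_nhds])
      then have "((\<lambda>s. B s x) \<longlongrightarrow> - l * (q - 1) * V x + lam 0 * r 0 * (V x)\<^sup>2) (at 0)"
        unfolding B_def by (intro tendsto_intros lim_lam lam_cont z)
      then have "((\<lambda>s. B s x) \<longlongrightarrow> f x) (at 0)"
        by (simp add: f_def r_def)
      then show "(\<lambda>k. B (s k) x) \<longlonglongrightarrow> f x"
        using s0 by (rule filterlim_compose)
    qed
  qed
  then have "annular_avg (\<lambda>x. zonal (J i) x * f x) = 0"
    using LIMSEQ_unique[of "\<lambda>k. 0::real"] by (simp add: B_avg[OF s(1,2)])
  then have "annular_avg (\<lambda>x. (- 1) * (zonal (J i) x * f x)) = 0"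
    by (simp only: annular_avg_cmult)
  also have "annular_avg (\<lambda>x. (- 1) * (zonal (J i) x * f x))
    = annular_avg (\<lambda>x. zonal (J i) x * (l * (q - 1) * V x + lam 0 * (q * (q - 1) / 2) * (V x)\<^sup>2))"
    by (rule annular_avg_cong) (simp only: f_def mult_minus1 mult_minus_right minus_minus)
  finally show ?thesis .
qed

end

section \<open>From the jointly smooth branch to its slices\<close>

lemma dderiv_slice: "dderiv (0, b) H (s, x) = dderiv b (\<lambda>y. H (s, y)) x"
  by (simp add: dderiv_def)

lemma slice_differentiable:
  fixes P :: "real \<times> 'a::euclidean_space \<Rightarrow> real"
  assumes "P differentiable (at (s, x))"
  shows "(\<lambda>y. P (s, y)) differentiable (at x)"
proof -
  have "(\<lambda>y. (s, y)) differentiable (at x)"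
    by (auto simp: differentiable_def intro!: exI derivative_intros)
  then have "(P \<circ> (\<lambda>y. (s, y))) differentiable (at x)"
    using assms by (rule differentiable_chain_at)
  then show ?thesis by (simp add: o_def)
qed

text \<open>Differentiating in a direction (0, b) commutes with freezing s, so joint regularity
  passes to the slice, through at most two derivatives in such directions.\<close>

lemma slice_hom0_C2:
  fixes H :: "real \<times> 'a::euclidean_space \<Rightarrow> real"
  assumes H: "\<And>vs p. set vs \<subseteq> Basis \<Longrightarrow> p \<in> T \<times> (- {0}) \<Longrightarrow> iter_dderiv vs H differentiable (at p)"
    and s: "s \<in> T" and hom: "\<And>r x. r > 0 \<Longrightarrow> H (s, r *\<^sub>R x) = H (s, x)"
  shows "hom0_C2 (\<lambda>x. H (s, x))"
proof -
  have slice: "(\<lambda>y. iter_dderiv vs H (s, y)) differentiable_on (- {0})" if "set vs \<subseteq> Basis" for vs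
    unfolding differentiable_on_punctured using slice_differentiable[OF H[OF that]] s by blast
  have "dderiv b (\<lambda>y. H (s, y)) differentiable_on (- {0})"
    "continuous_on (- {0}) (dderiv b (dderiv b (\<lambda>y. H (s, y))))" if "b \<in> Basis" for b
  proof -
    have B: "(0, b) \<in> Basis" using that by (simp add: Basis_prod_def)
    have 1: "(\<lambda>y. iter_dderiv [(0, b)] H (s, y)) = dderiv b (\<lambda>y. H (s, y))"
      by (simp add: iter_dderiv_def dderiv_slice fun_eq_iff)
    have 2: "(\<lambda>y. iter_dderiv [(0, b), (0, b)] H (s, y)) = dderiv b (dderiv b (\<lambda>y. H (s, y)))"
      by (simp add: iter_dderiv_def dderiv_slice[abs_def] fun_eq_iff)
    show "dderiv b (\<lambda>y. H (s, y)) differentiable_on (- {0})"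
      using slice[of "[(0, b)]"] B unfolding 1 by simp
    show "continuous_on (- {0}) (dderiv b (dderiv b (\<lambda>y. H (s, y))))"
      using slice[of "[(0, b), (0, b)]"] B unfolding 2 by (auto intro!: differentiable_imp_continuous_on)
  qed
  moreover have "(\<lambda>y. H (s, y)) differentiable_on (- {0})"
    using slice[of "[]"] by (simp add: iter_dderiv_def)
  ultimately show ?thesis using hom by (simp add: hom0_C2_def)
qed

theorem theorem1p2:
  fixes n d i :: nat and q c \<epsilon> :: real
    and F :: "real^'n \<Rightarrow> real"
    and u :: "real \<Rightarrow> real^'n \<Rightarrow> real" and lam :: "real \<Rightarrow> real"
  assumes dim: "CARD('n) = n + 1" and n3: "n \<ge> 3"
    and q1: "q > 1"
    and CM: "cartan_muenzner d c F" and c0: "c \<le> 0"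
    and i1: "i \<ge> 1"
    and eps: "\<epsilon> > 0"
    and smooth_u: "smooth_on ({-\<epsilon><..<\<epsilon>} \<times> (UNIV - {0}))
                     (\<lambda>(s, x). u s (x /\<^sub>R norm x))"
    and smooth_lam: "smooth_on {-\<epsilon><..<\<epsilon>} lam"
    and sol: "\<forall>s\<in>{-\<epsilon><..<\<epsilon>}. \<forall>x\<in>sphere 0 1.
                 - sphere_lap (u s) x + lam s * u s x = lam s * (u s x) powr q"
    and pos: "\<forall>s\<in>{-\<epsilon><..<\<epsilon>}. \<forall>x\<in>sphere 0 1. u s x > 0"
    and lampos: "\<forall>s\<in>{-\<epsilon><..<\<epsilon>}. lam s > 0"
    and inv: "\<forall>s\<in>{-\<epsilon><..<\<epsilon>}. f_invariant F (u s)"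
    and u0: "\<forall>x\<in>sphere 0 1. u 0 x = 1"
    and lam0: "lam 0 = real (d * i) * (real n + real (d * i) - 1) / (q - 1)"
    and nontriv: "\<forall>s\<in>{-\<epsilon><..<\<epsilon>}. s \<noteq> 0 \<longrightarrow> (\<exists>x\<in>sphere 0 1. u s x \<noteq> 1)"
    and eig_nz: "\<exists>x\<in>sphere 0 1. deriv (\<lambda>s. u s x) 0 \<noteq> 0"
    and eig_inv: "f_invariant F (\<lambda>x. deriv (\<lambda>s. u s x) 0)"
    and eig: "\<forall>x\<in>sphere 0 1. - sphere_lap (\<lambda>y. deriv (\<lambda>s. u s y) 0) x
                 = real (d * i) * (real n + real (d * i) - 1) * deriv (\<lambda>s. u s x) 0"
  shows "(c = 0 \<longrightarrow> (deriv lam 0 = 0 \<longleftrightarrow> odd i)) \<and>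
         (c \<noteq> 0 \<longrightarrow> deriv lam 0 \<noteq> 0)"
proof -
  have d1: "d \<ge> 1" and hp: "homog_poly d F"
    using CM by (simp_all add: cartan_muenzner_def)
  have card: "real CARD('n) = real n + 1" using dim by simp
  define a where "a = (real DIM(real^'n) - 2) / real d"
  define g where "g = (a + 1) / 2 - c / 4"
  interpret muenzner F d c a g
  proof
    show "radial_alg F" by (rule homog_poly_radial_alg[OF hp])
    show "F (r *\<^sub>R x) = r ^ d * F x" for r x by (rule homog_poly_scale[OF hp])
    show "grad_sq F x = (real d)\<^sup>2" if "norm x = 1" for x
    proof -
      have "x \<noteq> 0" using that by auto
      then show ?thesis using CM that by (simp add: cartan_muenzner_def)
    qed
    show "eucl_lap F x = c / 2 * (real d)\<^sup>2" if "norm x = 1" for x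
    proof -
      have "x \<noteq> 0" using that by auto
      then show ?thesis using CM that by (simp add: cartan_muenzner_def)
    qed
  qed (use d1 c0 dim n3 in \<open>simp_all add: a_def g_def\<close>)
  have ev: "ev i = real (d * i) * (real n + real (d * i) - 1)"
    by (simp add: ev_def card)

  define T where "T = {-\<epsilon><..<\<epsilon>}"
  define G where "G = (\<lambda>(s, x). u s (x /\<^sub>R norm x))"
  define U where "U s x = u s (x /\<^sub>R norm x)" for s x
  define H where "H = dderiv (1, 0) G"
  define V where "V x = deriv (\<lambda>s. u s (x /\<^sub>R norm x)) 0" for x
  have T0: "0 \<in> T" using eps by (simp add: T_def)
  have GU: "G (s, x) = U s x" for s x by (simp add: G_def U_def)
  have HV: "H (0, x) = V x" for x by (simp add: H_def dderiv_def G_def V_def)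
  have norm_scale: "(r *\<^sub>R x) /\<^sub>R norm (r *\<^sub>R x) = x /\<^sub>R norm x" if "r > 0" for r and x :: "real^'n"
    using that by (cases "x = 0") auto
  have U_hom: "U s (r *\<^sub>R x) = U s x" if "r > 0" for s r x
    unfolding U_def norm_scale[OF that] ..
  have G_smooth: "iter_dderiv vs G differentiable (at p)" if "set vs \<subseteq> Basis" "p \<in> T \<times> (- {0})" for vs p
  proof -
    have "open (T \<times> (- {0} :: (real^'n) set))" by (auto simp: T_def intro: open_Times)
    moreover have "iter_dderiv vs G differentiable_on T \<times> (- {0})"
      using smooth_u that(1) by (simp add: smooth_on_def T_def G_def Compl_eq_Diff_UNIV)
    ultimately show ?thesis using that(2) differentiable_on_eq_differentiable_at by blast
  qed
  have B1: "(1, 0) \<in> (Basis :: (real \<times> (real^'n)) set)" by (simp add: Basis_prod_def)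
  \<comment> \<open>\<open>foldr\<close> applies the last vector of the list first, so appending (1,
    0) takes the s-derivative before those in vs.\<close>
  have H_smooth: "iter_dderiv vs H differentiable (at p)" if "set vs \<subseteq> Basis" "p \<in> T \<times> (- {0})" for vs p
    using G_smooth[of "vs @ [(1, 0)]" p] that B1 by (simp add: iter_dderiv_def H_def)
  have U_C2: "hom0_C2 (U s)" if "s \<in> T" for s
    using slice_hom0_C2[of T G s] G_smooth that U_hom by (simp add: GU)
  have H_hom: "H (s, r *\<^sub>R x) = H (s, x)" if "r > 0" for s r x
    by (simp add: H_def dderiv_def GU U_hom[OF that])
  have V_C2: "hom0_C2 V"
    using slice_hom0_C2[OF H_smooth T0 H_hom] by (simp add: HV)
  have U_der: "((\<lambda>s. U s x) has_real_derivative H (s, x)) (at s)" if "s \<in> T" "x \<noteq> 0" for s x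
  proof -
    have "G differentiable (at (s, x))"
      using G_smooth[of "[]" "(s, x)"] that by (simp add: iter_dderiv_def)
    then have "((\<lambda>t. G ((s, x) + t *\<^sub>R (1, 0))) has_real_derivative H (s, x)) (at 0)"
      unfolding H_def by (rule dirderiv_dderiv)
    then show ?thesis
      using DERIV_shift[of "\<lambda>t. U t x" _ 0 s] by (simp add: GU add.commute)
  qed
  have sphere_id: "x /\<^sub>R norm x = x" if "norm x = 1" for x :: "real^'n"
    using that by simp

  have V_der: "((\<lambda>s. U s x) has_real_derivative V x) (at 0)" if "x \<noteq> 0" for x
    using U_der[OF T0 that] by (simp add: HV)
  obtain \<phi> where \<phi>: "\<And>x. norm x = 1 \<Longrightarrow> V x = \<phi> (F x)"
    using eig_inv unfolding f_invariant_def V_def by (auto simp: sphere_id)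
  have V_eig: "eucl_lap V x = - ev i * V x" if "norm x = 1" for x
  proof -
    have "sphere_lap (\<lambda>y. deriv (\<lambda>s. u s y) 0) x = eucl_lap V x"
      by (simp add: sphere_lap_def V_def[abs_def])
    moreover have "V x = deriv (\<lambda>s. u s x) 0" by (simp only: V_def sphere_id[OF that])
    moreover have "x \<in> sphere 0 1" using that by simp
    ultimately show ?thesis using eig ev by fastforce
  qed
  obtain z where z: "norm z = 1" "V z \<noteq> 0"
    using eig_nz sphere_id unfolding V_def by (metis mem_sphere_0)
  obtain b where b: "b \<noteq> 0" "\<And>x. x \<noteq> 0 \<Longrightarrow> V x = b * zonal (J i) x" and L2: "L (J i * J i) > 0"
    using invariant_eigenfunction[OF V_C2 \<phi> V_eig z] by blast

  \<comment> \<open>Halving the interval keeps this compact set inside the domain of smoothness. The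
    resulting bound on the s-derivative gives |U s x - 1| \<le> K s, the domination used in
    \<open>bifurcation_identity\<close>.\<close>
  have "compact ({0..\<epsilon> / 2} \<times> sphere (0::real^'n) 1)"
    by (intro compact_Times) auto
  moreover have "continuous_on ({0..\<epsilon> / 2} \<times> sphere 0 1) H"
  proof (rule continuous_at_imp_continuous_on, rule ballI)
    fix p assume p: "p \<in> {0..\<epsilon> / 2} \<times> sphere (0::real^'n) 1"
    then have "p \<in> T \<times> (- {0})" using eps by (auto simp: T_def)
    then have "H differentiable (at p)"
      using H_smooth[of "[]" p] by (simp add: iter_dderiv_def)
    then show "isCont H p" by (rule differentiable_imp_continuous_within)
  qed
  ultimately have "bounded (H ` ({0..\<epsilon> / 2} \<times> sphere 0 1))"
    by (intro compact_imp_bounded compact_continuous_image)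
  then obtain K where K: "\<And>s x. 0 \<le> s \<Longrightarrow> s \<le> \<epsilon> / 2 \<Longrightarrow> norm x = 1 \<Longrightarrow> \<bar>H (s, x)\<bar> \<le> K"
    unfolding bounded_iff by force
  have U0: "U 0 x = 1" if "x \<noteq> 0" for x
    using u0 that by (simp add: U_def)
  have U_bound: "\<bar>U s x - 1\<bar> \<le> K * s" if s: "0 < s" "s < \<epsilon> / 2" and x: "x \<noteq> 0" for s x
  proof -
    let ?y = "x /\<^sub>R norm x"
    have y: "norm ?y = 1" by (rule sphere_normalize[OF x])
    then have y0: "?y \<noteq> 0" by auto
    have "\<exists>t. t > 0 \<and> t < s \<and> U s ?y - U 0 ?y = (s - 0) * H (t, ?y)"
      by (rule MVT2[OF s(1)], rule U_der) (use s y0 in \<open>auto simp: T_def\<close>)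
    then obtain t where t: "0 < t" "t < s" "U s ?y - U 0 ?y = s * H (t, ?y)" by auto
    have "U s ?y = U s x" using x by (intro U_hom) simp
    then have "\<bar>U s x - 1\<bar> = s * \<bar>H (t, ?y)\<bar>"
      using t(3) U0[OF y0] s(1) by (simp add: abs_mult)
    also have "\<dots> \<le> s * K"
      by (intro mult_left_mono K y) (use s t in auto)
    finally show ?thesis by (simp add: mult.commute)
  qed

  have lam_diff: "(lam has_real_derivative deriv lam 0) (at 0)"
  proof -
    have "iter_dderiv [] lam differentiable_on T"
      using smooth_lam unfolding smooth_on_def T_def by (metis empty_set empty_subsetI)
    then have "lam differentiable (at 0)"
      using T0 by (simp add: iter_dderiv_def T_def differentiable_on_eq_differentiable_at)
    then show ?thesis by (simp add: DERIV_deriv_iff_real_differentiable)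
  qed
  define \<kappa> where "\<kappa> = lam 0 * (q * (q - 1) / 2)"
  have "annular_avg (\<lambda>x. zonal (J i) x * (deriv lam 0 * (q - 1) * V x + lam 0 * (q * (q - 1) / 2) * (V x)\<^sup>2)) = 0"
  proof (rule bifurcation_identity[where \<epsilon> = "\<epsilon> / 2" and K = K and U = U])
    show "hom0_C2 (U s)" if "0 < s" "s < \<epsilon> / 2" for s
      by (rule U_C2) (use that in \<open>simp add: T_def\<close>)
    show "eucl_lap (U s) x = lam s * U s x - lam s * U s x powr q"
      if "0 < s" "s < \<epsilon> / 2" "norm x = 1" for s x
    proof -
      have "sphere_lap (u s) x = eucl_lap (U s) x" by (simp add: sphere_lap_def U_def[abs_def])
      moreover have "U s x = u s x" by (simp only: U_def sphere_id[OF that(3)])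
      moreover have "- sphere_lap (u s) x + lam s * u s x = lam s * u s x powr q"
        using sol that by simp
      ultimately show ?thesis by simp
    qed
    show "U s x > 0" if "0 < s" "s < \<epsilon> / 2" "x \<noteq> 0" for s x
      using pos that by (simp add: U_def)
    show "lam 0 * (q - 1) = ev i" using lam0 q1 by (simp add: ev)
    show "continuous_on (- {0}) V" by (rule hom0_C2_cont[OF V_C2])
  qed (use i1 eps U0 lam_diff V_der U_bound in auto)
  also have "annular_avg (\<lambda>x. zonal (J i) x * (deriv lam 0 * (q - 1) * V x + lam 0 * (q * (q - 1) / 2) * (V x)\<^sup>2))
    = annular_avg (zonal (smult (deriv lam 0 * (q - 1) * b) (J i * J i) + smult (\<kappa> * b\<^sup>2) (J i * J i * J i)))"
    by (rule annular_avg_cong) (simp add: b(2) zonal_def \<kappa>_def power2_eq_square algebra_simps)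
  also have "\<dots> = deriv lam 0 * (q - 1) * b * L (J i * J i) + \<kappa> * b\<^sup>2 * L (J i * J i * J i)"
    by (simp only: L_def[symmetric] L_add L_smult)
  finally have "b * (deriv lam 0 * (q - 1) * L (J i * J i) + \<kappa> * b * L (J i * J i * J i)) = 0"
    by (simp add: power2_eq_square algebra_simps)
  \<comment> \<open>One factor b \<noteq> 0 has been cancelled. Apart from
    \<open>deriv lam 0\<close> and the cube, all factors are nonzero, by q > 1, lam 0 > 0 and
    \<open>L2\<close>.\<close>
  then have eq: "deriv lam 0 * ((q - 1) * L (J i * J i)) = - (\<kappa> * b) * L (J i * J i * J i)"
    using b(1) by simp
  have "lam 0 > 0" using lampos T0 unfolding T_def by blast
  then have "\<kappa> \<noteq> 0" using q1 by (simp add: \<kappa>_def)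
  moreover have "(q - 1) * L (J i * J i) \<noteq> 0" using L2 q1 by simp
  ultimately have "deriv lam 0 = 0 \<longleftrightarrow> L (J i * J i * J i) = 0"
    using eq b(1) by (metis mult_eq_0_iff neg_equal_0_iff_equal)
  then show ?thesis using L_cube_eq_0_iff[OF L2] i1 by auto
qed

end
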